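(* Fix $\eta\in(0,1)$, and let $N>0$, $\varepsilon\geq 2^{-N}$, and $1\le t\leq\eta N$. Let $T$ be the optimal (minimal) number of queries a quantum computer needs to search with error $\leq\varepsilon$ through an unordered list of $N$ items (an input $x\in\{0,1\}^N$) containing at least $t$ solutions. Then $$\log(1/\varepsilon)\in\Theta\left(\frac{T^2}{N}+T\sqrt{\frac{t}{N}}\right).$$
   Context: Quantum query model: the input $x\in\{0,1\}^N$ is accessible only via the query gate $|j,b\rangle\mapsto|j,b\oplus x_j\rangle$; a $T$-query algorithm interleaves $T$ such gates with input-independent unitaries starting from a fixed state, and ends with a measurement. A solution is an index $j$ with $x_j=1$; a search algorithm outputs an index, and it has error $\le\varepsilon$ if on every input with at least $t$ solutions the probability that the output is not a solution is at most $\varepsilon$.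
   Formalization: The error is additionally assumed to satisfy ε < 1 − t/N (otherwise T = 0) and ε ≤ ε0 for an arbitrary fixed ε0 < 1, with the constants in Θ depending on η and ε0; without these conditions the claim fails. *)

theory Defs
  imports Complex_Main "HOL-Library.Landau_Symbols" "Jordan_Normal_Form.Schur_Decomposition"
begin

text \<open>
  Inputs in \<open>{0,1}\<^sup>N\<close> are functions \<open>x :: nat \<Rightarrow> bool\<close>, of which only the values \<open>x j\<close> with
  \<open>j < N\<close> are ever inspected.
\<close>

definition solutions :: "nat \<Rightarrow> (nat \<Rightarrow> bool) \<Rightarrow> nat set" where
  "solutions N x = {j. j < N \<and> x j}"

text \<open>
  A state lives in \<open>\<complex>\<^sup>N \<otimes> \<complex>\<^sup>2 \<otimes> \<complex>\<^sup>W\<close> (index register, target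
  bit, workspace).  The basis vector with number \<open>i < 2 * N * W\<close> is \<open>|j, b, w\<rangle>\<close> where
  \<open>i = j + N * (b + 2 * w)\<close>; \<open>registers\<close> recovers \<open>(j, b, w)\<close> from \<open>i\<close>.
\<close>

definition registers :: "nat \<Rightarrow> nat \<Rightarrow> nat \<times> bool \<times> nat" where
  "registers N i = (i mod N, odd (i div N), i div (2 * N))"

text \<open>The gate \<open>|j, b, w\<rangle> \<mapsto> |j, b \<oplus> x j, w\<rangle>\<close>; on \<open>bool\<close>, \<open>\<oplus>\<close> is \<open>\<noteq>\<close>.\<close>

definition query_gate :: "nat \<Rightarrow> nat \<Rightarrow> (nat \<Rightarrow> bool) \<Rightarrow> complex mat" where
  "query_gate N W x = mat (2 * N * W) (2 * N * W)
     (\<lambda>(r, c). case registers N c of (j, b, w) \<Rightarrow> of_bool (registers N r = (j, b \<noteq> x j, w)))"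

definition unitary :: "nat \<Rightarrow> complex mat \<Rightarrow> bool" where
  "unitary n U \<longleftrightarrow> U \<in> carrier_mat n n \<and> mat_adjoint U * U = 1\<^sub>m n \<and> U * mat_adjoint U = 1\<^sub>m n"

text \<open>
  The final measurement is in the computational basis, outcome \<open>i\<close> being reported as the index
  \<open>outcome A i\<close>.  As the last unitary is arbitrary, this covers every projective measurement with
  outcomes in \<open>{..<N}\<close>, and, as the workspace is arbitrary, every generalised one.
\<close>

record query_algorithm =
  work_dim :: nat
  start :: "complex vec"
  gate :: "nat \<Rightarrow> complex mat"
  outcome :: "nat \<Rightarrow> nat"

definition valid_algorithm :: "nat \<Rightarrow> nat \<Rightarrow> query_algorithm \<Rightarrow> bool" where
  "valid_algorithm N T A \<longleftrightarrow>
     (let d = 2 * N * work_dim A in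
        0 < work_dim A \<and>
        start A \<in> carrier_vec d \<and> start A \<bullet>c start A = 1 \<and>
        (\<forall>k\<le>T. unitary d (gate A k)) \<and>
        (\<forall>i<d. outcome A i < N))"

primrec state :: "nat \<Rightarrow> query_algorithm \<Rightarrow> (nat \<Rightarrow> bool) \<Rightarrow> nat \<Rightarrow> complex vec" where
  "state N A x 0 = gate A 0 *\<^sub>v start A"
| "state N A x (Suc k) = gate A (Suc k) *\<^sub>v (query_gate N (work_dim A) x *\<^sub>v state N A x k)"

definition output_prob :: "nat \<Rightarrow> nat \<Rightarrow> query_algorithm \<Rightarrow> (nat \<Rightarrow> bool) \<Rightarrow> nat \<Rightarrow> real" where
  "output_prob N T A x j =
     (\<Sum>i | i < 2 * N * work_dim A \<and> outcome A i = j. (cmod (state N A x T $ i))\<^sup>2)"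

definition search_error_le :: "nat \<Rightarrow> nat \<Rightarrow> nat \<Rightarrow> query_algorithm \<Rightarrow> real \<Rightarrow> bool" where
  "search_error_le N t T A \<epsilon> \<longleftrightarrow>
     (\<forall>x. t \<le> card (solutions N x) \<longrightarrow>
        (\<Sum>j\<in>{..<N} - solutions N x. output_prob N T A x j) \<le> \<epsilon>)"

text \<open>
  For \<open>N, t \<ge> 1\<close> and \<open>\<epsilon> \<ge> 0\<close> the \<open>LEAST\<close> ranges over a nonempty set, since querying all \<open>N\<close>
  positions finds a solution with certainty.
\<close>

definition optimal_queries :: "nat \<Rightarrow> nat \<Rightarrow> real \<Rightarrow> nat" where
  "optimal_queries N t \<epsilon> = (LEAST T. \<exists>A. valid_algorithm N T A \<and> search_error_le N t T A \<epsilon>)"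

text \<open>
  The set over which the constants hidden in the Theta are uniform, for fixed \<open>\<eta>\<close> and \<open>\<epsilon>0\<close>; Theta with
  respect to \<open>principal S\<close> means two-sided bounds valid at every point of \<open>S\<close>.

  The last two bounds on \<open>\<epsilon>\<close> keep the error away from trivial values, where the equivalence fails:
  \<^item> A uniformly random index is wrong with probability at most \<open>1 - t / N\<close>, so for
    \<open>\<epsilon> \<ge> 1 - t / N\<close> no query is needed and \<open>T\<^sup>2 / N + T * sqrt (t / N)\<close> is \<open>0\<close>, whereas
    \<open>log 2 (1 / \<epsilon>)\<close> need not be.
  \<^item> Querying one random index, and guessing afresh if it is not a solution, has error
    \<open>(1 - t / N)\<^sup>2\<close>.  For this \<open>\<epsilon>\<close> the optimum is \<open>T = 1\<close>, but if \<open>t / N\<close> is small then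
    \<open>log 2 (1 / \<epsilon>)\<close> is of order \<open>t / N\<close>, much smaller than \<open>sqrt (t / N)\<close>.  Hence \<open>\<epsilon>\<close> has to be
    bounded away from \<open>1\<close>; any fixed bound \<open>\<epsilon>0 < 1\<close> is allowed.
\<close>

definition search_params :: "real \<Rightarrow> real \<Rightarrow> (nat \<times> nat \<times> real) set" where
  "search_params \<eta> \<epsilon>0 =
     {(N, t, \<epsilon>). 0 < N \<and> 1 \<le> t \<and> real t \<le> \<eta> * real N \<and>
        1 / 2 ^ N \<le> \<epsilon> \<and> \<epsilon> \<le> \<epsilon>0 \<and> \<epsilon> < 1 - real t / real N}"

end

theory Submission
  imports "HOL-Complex_Analysis.Conformal_Mappings" Defs
begin

text \<open>
  Lower bound on the number of queries.  If every bit of the input is set independently with probability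
  \<open>q\<close>, then the expected error of a \<open>T\<close>-query algorithm is a polynomial in \<open>q\<close> of degree at most
  \<open>2 * T + 1\<close>.  It is \<open>1\<close> at \<open>q = 0\<close>, and for \<open>q\<close> somewhat larger than \<open>t / N\<close> it is at most \<open>\<epsilon>\<close> plus the
  probability of having fewer than \<open>t\<close> solutions.  A polynomial bounded by \<open>M\<close> on \<open>[a, 1]\<close> is at most
  \<open>M * exp (O (T * sqrt a))\<close> at \<open>0\<close>.  The choice of \<open>a\<close> as a multiple of \<open>(t + log (1 / \<epsilon>)) / N\<close> makes the tail
  probability comparable to a power of \<open>\<epsilon>\<close>.  Since all real \<open>q\<close> in \<open>[a, 1]\<close> are available, no bound for
  polynomials known only at integers (Coppersmith and Rivlin) is needed.

  Upper bound.  Let \<open>n = \<lceil>log (1 / \<epsilon>)\<rceil>\<close> and \<open>K = max t n\<close>.  For every \<open>k\<close> from \<open>t\<close> to \<open>K - 1\<close> run a Grover search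
  that is exact for \<open>k\<close> solutions; then run \<open>n\<close> times the Grover searches with \<open>1, 2, 4, \<dots>\<close> iterations up to
  order \<open>sqrt (N / K)\<close>, one of which fails with probability at most \<open>1 / 2\<close> when there are at least \<open>K\<close>
  solutions.  After a failed search the state is again the uniform superposition of the non-solutions, from
  which the next search starts, so the failure amplitudes multiply.  Adding \<open>N\<close> dummy items keeps the Grover
  angle in \<open>(0, pi / 2]\<close>.
\<close>

unbundle no vec_syntax
no_notation inner (infix "\<bullet>" 70)
hide_type (open) Finite_Cartesian_Product.vec
hide_const (open) Finite_Cartesian_Product.vec Finite_Cartesian_Product.mat

subsection \<open>Amplitudes and unitary matrices\<close>

lemma sum_of_bool_eq_mult:
  fixes f :: "'b \<Rightarrow> 'a :: semiring_1"
  assumes "finite A" "a \<in> A"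
  shows "(\<Sum>b\<in>A. of_bool (b = a) * f b) = f a"
proof -
  have "(\<Sum>b\<in>A. of_bool (b = a) * f b) = (\<Sum>b\<in>A. if b = a then f b else 0)"
    by (intro sum.cong) auto
  thus ?thesis using assms by simp
qed

section \<open>Basis states as register triples\<close>

definition register_set :: "nat \<Rightarrow> nat \<Rightarrow> (nat \<times> bool \<times> nat) set" where
  "register_set N W = {..<N} \<times> UNIV \<times> {..<W}"

text \<open>Inverse of \<open>registers\<close> on the basis. Amplitudes are addressed by triples
  from here on, which confines the arithmetic of \<open>div\<close> and \<open>mod\<close> to the
  next few lemmas.\<close>

definition basis_index :: "nat \<Rightarrow> nat \<times> bool \<times> nat \<Rightarrow> nat" where
  "basis_index N = (\<lambda>(j, b, w). j + N * (of_bool b + 2 * w))"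

lemma finite_register_set [simp]: "finite (register_set N W)"
  by (simp add: register_set_def)

lemma registers_basis_index:
  assumes "r \<in> register_set N W"
  shows "registers N (basis_index N r) = r"
proof -
  obtain j b w where r: "r = (j, b, w)" and j: "j < N"
    using assms by (auto simp: register_set_def)
  have "(j + N * m) div (2 * N) = m div 2" for m
  proof -
    have "(j + N * m) div (N * 2) = (j + N * m) div N div 2"
      by (rule div_mult2_eq)
    thus ?thesis using j by (simp add: mult.commute)
  qed
  thus ?thesis
    using j by (simp add: r registers_def basis_index_def)
qed

lemma basis_index_registers:
  assumes "0 < N"
  shows "basis_index N (registers N i) = i"
proof -
  have "i div (2 * N) = i div N div 2"
    by (metis div_mult2_eq mult.commute)
  moreover have "of_bool (odd m) + 2 * (m div 2) = m" for m :: nat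
    by (auto simp: odd_iff_mod_2_eq_one)
  ultimately show ?thesis
    by (simp add: registers_def basis_index_def)
qed

lemma basis_index_less:
  assumes "r \<in> register_set N W"
  shows "basis_index N r < 2 * N * W"
proof -
  obtain j b w where r: "r = (j, b, w)" and j: "j < N" and w: "w < W"
    using assms by (auto simp: register_set_def)
  have "of_bool b + 2 * w + 1 \<le> 2 * W"
    using w by (cases b) auto
  hence "N * (of_bool b + 2 * w + 1) \<le> N * (2 * W)"
    by (rule mult_le_mono2)
  thus ?thesis
    using j by (simp add: r basis_index_def algebra_simps)
qed

lemma registers_in_register_set:
  assumes "i < 2 * N * W"
  shows "registers N i \<in> register_set N W"
proof -
  have "0 < N" using assms by (cases N) auto
  thus ?thesis
    using assms less_mult_imp_div_less[of i W "2 * N"]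
    by (simp add: registers_def register_set_def mult.commute)
qed

lemma sum_basis_index:
  fixes f :: "nat \<Rightarrow> 'a :: comm_monoid_add"
  assumes "0 < N"
  shows "(\<Sum>i<2 * N * W. f i) = (\<Sum>r\<in>register_set N W. f (basis_index N r))"
  by (rule sum.reindex_bij_witness[where i = "basis_index N" and j = "registers N"])
     (use assms in \<open>auto simp: registers_basis_index basis_index_registers basis_index_less
        registers_in_register_set\<close>)

definition flip_target :: "(nat \<Rightarrow> bool) \<Rightarrow> nat \<times> bool \<times> nat \<Rightarrow> nat \<times> bool \<times> nat" where
  "flip_target x = (\<lambda>(j, b, w). (j, b \<noteq> x j, w))"

lemma flip_target_flip_target [simp]: "flip_target x (flip_target x r) = r"
  by (auto simp: flip_target_def split: prod.splits)

lemma flip_target_in_register_set [simp]: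
  "flip_target x r \<in> register_set N W \<longleftrightarrow> r \<in> register_set N W"
  by (auto simp: flip_target_def register_set_def split: prod.splits)

lemma query_gate_carrier [simp]:
  "query_gate N W x \<in> carrier_mat (2 * N * W) (2 * N * W)"
  by (simp add: query_gate_def)

text \<open>The gate permutes the basis by \<open>flip_target x\<close>. Since this permutation is
  an involution, the condition on a matrix entry can be solved for the column, and each row picks
  out a single amplitude.\<close>

lemma query_gate_amplitude:
  assumes r: "r \<in> register_set N W" and v: "v \<in> carrier_vec (2 * N * W)"
  shows "(query_gate N W x *\<^sub>v v) $ basis_index N r = v $ basis_index N (flip_target x r)"
proof -
  have N: "0 < N" using r by (auto simp: register_set_def)
  have entry: "query_gate N W x $$ (basis_index N r, i) = of_bool (registers N i = flip_target x r)"
    if "i < 2 * N * W" for i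
    using that basis_index_less[OF r] registers_basis_index[OF r]
    by (auto simp: query_gate_def flip_target_def split: prod.splits)
  have "(query_gate N W x *\<^sub>v v) $ basis_index N r =
      (\<Sum>i<2 * N * W. query_gate N W x $$ (basis_index N r, i) * v $ i)"
    using v basis_index_less[OF r] carrier_matD[OF query_gate_carrier[of N W x]]
    by (simp add: scalar_prod_def atLeast0LessThan)
  also have "\<dots> = (\<Sum>i<2 * N * W. of_bool (registers N i = flip_target x r) * v $ i)"
    by (simp add: entry)
  also have "\<dots> = (\<Sum>c\<in>register_set N W. of_bool (c = flip_target x r) * v $ basis_index N c)"
    unfolding sum_basis_index[OF N]
    by (intro sum.cong refl) (auto simp: registers_basis_index)
  also have "\<dots> = v $ basis_index N (flip_target x r)"
    using r by (intro sum_of_bool_eq_mult) auto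
  finally show ?thesis .
qed

section \<open>Norms and unitarity\<close>

definition sq_norm_vec :: "complex vec \<Rightarrow> real" where
  "sq_norm_vec v = (\<Sum>i<dim_vec v. (cmod (v $ i))\<^sup>2)"

lemma cscalar_prod_self: "v \<bullet>c v = of_real (sq_norm_vec v)"
  by (simp add: sq_norm_vec_def scalar_prod_def complex_norm_square atLeast0LessThan
      del: of_real_power)

lemma mat_adjoint_index:
  fixes A :: "complex mat"
  assumes "i < dim_col A" "j < dim_row A"
  shows "mat_adjoint A $$ (i, j) = cnj (A $$ (j, i))"
  using assms by (simp add: mat_adjoint_def mat_of_rows_index)

lemma dim_mat_adjoint [simp]:
  fixes A :: "complex mat"
  shows "dim_row (mat_adjoint A) = dim_col A" "dim_col (mat_adjoint A) = dim_row A"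
  by (simp_all add: mat_adjoint_def)

lemma mat_adjoint_carrier [simp]:
  "A \<in> carrier_mat n m \<Longrightarrow> mat_adjoint A \<in> carrier_mat m n"
  by (auto simp: mat_adjoint_def)

lemma sq_norm_vec_unitary:
  assumes U: "unitary n U" and v: "v \<in> carrier_vec n"
  shows "sq_norm_vec (U *\<^sub>v v) = sq_norm_vec v"
proof -
  have Uc: "U \<in> carrier_mat n n" and UU: "mat_adjoint U * U = 1\<^sub>m n"
    using U by (auto simp: unitary_def)
  have orth: "(\<Sum>i<n. U $$ (i, a) * cnj (U $$ (i, b))) = of_bool (a = b)" if "a < n" "b < n" for a b
  proof -
    have "(mat_adjoint U * U) $$ (b, a) = (\<Sum>i<n. cnj (U $$ (i, b)) * U $$ (i, a))"
      using that carrier_matD[OF Uc]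
      by (simp add: scalar_prod_def mat_adjoint_index atLeast0LessThan)
    moreover have "(mat_adjoint U * U) $$ (b, a) = of_bool (a = b)"
      using that by (auto simp: UU)
    ultimately show ?thesis
      by (simp add: mult.commute)
  qed
  have "complex_of_real (sq_norm_vec (U *\<^sub>v v)) =
      (\<Sum>i<n. (\<Sum>a<n. U $$ (i, a) * v $ a) * (\<Sum>b<n. cnj (U $$ (i, b)) * cnj (v $ b)))"
    using Uc v
    by (auto simp: sq_norm_vec_def complex_norm_square scalar_prod_def atLeast0LessThan
        simp del: of_real_power intro!: sum.cong)
  also have "\<dots> = (\<Sum>i<n. \<Sum>a<n. \<Sum>b<n. v $ a * cnj (v $ b) * (U $$ (i, a) * cnj (U $$ (i, b))))"
    by (simp add: sum_product mult_ac)
  also have "\<dots> = (\<Sum>a<n. \<Sum>i<n. \<Sum>b<n. v $ a * cnj (v $ b) * (U $$ (i, a) * cnj (U $$ (i, b))))"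
    by (rule sum.swap)
  also have "\<dots> = (\<Sum>a<n. \<Sum>b<n. \<Sum>i<n. v $ a * cnj (v $ b) * (U $$ (i, a) * cnj (U $$ (i, b))))"
    by (rule sum.cong[OF refl], rule sum.swap)
  also have "\<dots> = (\<Sum>a<n. \<Sum>b<n. of_bool (b = a) * (v $ a * cnj (v $ b)))"
    by (intro sum.cong refl) (auto simp: orth sum_distrib_left[symmetric])
  also have "\<dots> = (\<Sum>a<n. v $ a * cnj (v $ a))"
    by (intro sum.cong refl sum_of_bool_eq_mult) auto
  also have "\<dots> = of_real (sq_norm_vec v)"
    using v by (simp add: sq_norm_vec_def complex_norm_square del: of_real_power)
  finally show ?thesis
    using of_real_eq_iff by blast
qed

lemma sq_norm_vec_query_gate:
  assumes "0 < N" and v: "v \<in> carrier_vec (2 * N * W)"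
  shows "sq_norm_vec (query_gate N W x *\<^sub>v v) = sq_norm_vec v"
proof -
  have d: "dim_vec (query_gate N W x *\<^sub>v v) = 2 * N * W"
    by (simp add: query_gate_def)
  have "(\<Sum>r\<in>register_set N W. (cmod (v $ basis_index N (flip_target x r)))\<^sup>2) =
      (\<Sum>r\<in>register_set N W. (cmod (v $ basis_index N r))\<^sup>2)"
    by (rule sum.reindex_bij_witness[where i = "flip_target x" and j = "flip_target x"]) auto
  thus ?thesis
    unfolding sq_norm_vec_def d carrier_vecD[OF v] sum_basis_index[OF assms(1)]
    by (simp add: query_gate_amplitude[OF _ v] del: index_mult_mat_vec)
qed

text \<open>Orthonormal rows suffice, as a right inverse of a square matrix is also a left
  inverse.\<close>

lemma unitaryI:
  assumes "\<And>r s. r < n \<Longrightarrow> s < n \<Longrightarrow> (\<Sum>c<n. K r c * cnj (K s c)) = of_bool (r = s)"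
  shows "unitary n (mat n n (\<lambda>(r, c). K r c))"
proof -
  let ?U = "mat n n (\<lambda>(r, c). K r c)"
  have U: "?U \<in> carrier_mat n n" by simp
  have *: "?U * mat_adjoint ?U = 1\<^sub>m n"
    by (rule eq_matI) (use assms in \<open>auto simp: scalar_prod_def mat_adjoint_index atLeast0LessThan\<close>)
  thus ?thesis
    using U mat_mult_left_right_inverse[OF U mat_adjoint_carrier[OF U] *]
    by (simp add: unitary_def)
qed

lemma unitary_one: "unitary n (1\<^sub>m n)"
proof -
  have "(\<Sum>c<n. of_bool (r = c) * cnj (of_bool (s = c))) = (of_bool (r = s) :: complex)"
    if "r < n" for r s
  proof -
    have "(\<Sum>c<n. of_bool (r = c) * cnj (of_bool (s = c))) =
        (\<Sum>c<n. of_bool (c = r) * (of_bool (s = c) :: complex))"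
      by (intro sum.cong) auto
    also have "\<dots> = of_bool (s = r)"
      using that by (intro sum_of_bool_eq_mult) auto
    also have "\<dots> = of_bool (r = s)"
      by auto
    finally show ?thesis .
  qed
  hence "unitary n (mat n n (\<lambda>(r, c). of_bool (r = c)))"
    by (intro unitaryI)
  also have "mat n n (\<lambda>(r, c). of_bool (r = c)) = 1\<^sub>m n"
    by (rule eq_matI) auto
  finally show ?thesis .
qed

subsection \<open>The expected error as a polynomial\<close>

text \<open>Monomials are indexed by sets because bits are idempotent: the product of two monomials
  is the monomial of the union, so degrees are subadditive. \<open>d\<close> is only an upper bound
  on the degree.\<close>

inductive multilinear_poly :: "nat \<Rightarrow> nat \<Rightarrow> ((nat \<Rightarrow> bool) \<Rightarrow> complex) \<Rightarrow> bool"
  for N d where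
  monom: "A \<subseteq> {..<N} \<Longrightarrow> card A \<le> d \<Longrightarrow> multilinear_poly N d (\<lambda>x. c * of_bool (\<forall>j\<in>A. x j))"
| add: "multilinear_poly N d f \<Longrightarrow> multilinear_poly N d g \<Longrightarrow> multilinear_poly N d (\<lambda>x. f x + g x)"

lemma multilinear_poly_mono:
  assumes "multilinear_poly N d f" "d \<le> e"
  shows "multilinear_poly N e f"
  using assms by induction (auto intro: multilinear_poly.intros)

lemma multilinear_poly_const: "multilinear_poly N d (\<lambda>x. c)"
  using multilinear_poly.monom[of "{}" N d c] by simp

lemma multilinear_poly_var: "j < N \<Longrightarrow> multilinear_poly N 1 (\<lambda>x. of_bool (x j))"
  using multilinear_poly.monom[of "{j}" N 1 1] by simp

lemma multilinear_poly_cnj: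
  assumes "multilinear_poly N d f"
  shows "multilinear_poly N d (\<lambda>x. cnj (f x))"
  using assms
proof induction
  case (monom A c)
  hence "multilinear_poly N d (\<lambda>x. cnj c * of_bool (\<forall>j\<in>A. x j))"
    by (rule multilinear_poly.monom)
  moreover have "cnj (of_bool P) = of_bool P" for P by (cases P) auto
  ultimately show ?case by simp
next
  case (add f g)
  thus ?case using multilinear_poly.add by fastforce
qed

lemma multilinear_poly_sum:
  assumes "finite I" "\<And>i. i \<in> I \<Longrightarrow> multilinear_poly N d (f i)"
  shows "multilinear_poly N d (\<lambda>x. \<Sum>i\<in>I. f i x)"
  using assms
  by (induction I rule: finite_induct) (auto intro: multilinear_poly_const multilinear_poly.add)

lemma multilinear_poly_mult_monom:
  assumes "multilinear_poly N e g" "A \<subseteq> {..<N}" "card A \<le> d"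
  shows "multilinear_poly N (d + e) (\<lambda>x. c * of_bool (\<forall>j\<in>A. x j) * g x)"
  using assms(1)
proof induction
  case (monom B c')
  have "card (A \<union> B) \<le> d + e"
    using card_Un_le[of A B] monom assms by linarith
  hence "multilinear_poly N (d + e) (\<lambda>x. (c * c') * of_bool (\<forall>j\<in>A \<union> B. x j))"
    using assms monom by (intro multilinear_poly.monom) auto
  moreover have "c * of_bool (\<forall>j\<in>A. x j) * (c' * of_bool (\<forall>j\<in>B. x j)) =
      (c * c') * of_bool (\<forall>j\<in>A \<union> B. x j)" for x :: "nat \<Rightarrow> bool"
    by (auto simp: of_bool_def)
  ultimately show ?case by (simp only:)
next
  case (add f g)
  thus ?case using multilinear_poly.add by (fastforce simp: distrib_left)
qed

lemma multilinear_poly_mult: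
  assumes "multilinear_poly N d f" "multilinear_poly N e g"
  shows "multilinear_poly N (d + e) (\<lambda>x. f x * g x)"
  using assms(1)
proof induction
  case (monom A c)
  thus ?case using multilinear_poly_mult_monom[OF assms(2)] by blast
next
  case (add f g)
  thus ?case using multilinear_poly.add by (fastforce simp: distrib_right)
qed

section \<open>Inputs with independent random bits\<close>

definition bernoulli_expectation :: "nat \<Rightarrow> complex \<Rightarrow> ((nat \<Rightarrow> bool) \<Rightarrow> complex) \<Rightarrow> complex" where
  "bernoulli_expectation N q f =
     (\<Sum>X\<in>Pow {..<N}. q ^ card X * (1 - q) ^ (N - card X) * f (\<lambda>j. j \<in> X))"

lemma bernoulli_expectation_monom:
  assumes "A \<subseteq> {..<N}"
  shows "bernoulli_expectation N q (\<lambda>x. of_bool (\<forall>j\<in>A. x j)) = q ^ card A"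
proof -
  \<comment> \<open>The zeros of \<open>?g\<close> on \<open>A\<close> kill every \<open>X\<close>
    that does not contain \<open>A\<close>, and each factor outside \<open>A\<close> is
    \<open>q + (1 - q) = 1\<close>.\<close>
  let ?g = "\<lambda>j. if j \<in> A then 0 else 1 - q"
  have fin: "finite A" using assms finite_subset by blast
  have "q ^ card A = (\<Prod>j<N. if j \<in> A then q else 1)"
    using assms by (simp add: prod.If_cases Int_absorb1)
  also have "\<dots> = (\<Prod>j<N. q + ?g j)"
    by (intro prod.cong) auto
  also have "\<dots> = (\<Sum>X\<in>Pow {..<N}. (\<Prod>j\<in>X. q) * (\<Prod>j\<in>{..<N} - X. ?g j))"
    by (rule prod_add) simp
  also have "\<dots> = bernoulli_expectation N q (\<lambda>x. of_bool (\<forall>j\<in>A. x j))"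
    unfolding bernoulli_expectation_def
  proof (rule sum.cong[OF refl])
    fix X assume X: "X \<in> Pow {..<N}"
    hence fX: "finite X" using finite_subset by blast
    have "(\<Prod>j\<in>{..<N} - X. ?g j) = (1 - q) ^ (N - card X) * of_bool (\<forall>j\<in>A. j \<in> X)"
    proof (cases "A \<subseteq> X")
      case True
      hence "(\<Prod>j\<in>{..<N} - X. ?g j) = (\<Prod>j\<in>{..<N} - X. 1 - q)"
        by (intro prod.cong) auto
      also have "\<dots> = (1 - q) ^ (N - card X)"
        using X fX by (simp add: card_Diff_subset)
      finally show ?thesis using True by auto
    next
      case False
      then obtain j where "j \<in> A" "j \<notin> X" by blast
      hence "(\<Prod>j\<in>{..<N} - X. ?g j) = 0"
        using assms by (intro prod_zero) auto
      moreover have "of_bool (\<forall>j\<in>A. j \<in> X) = (0 :: complex)" using False by auto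
      ultimately show ?thesis by (simp only: mult_zero_right)
    qed
    thus "(\<Prod>j\<in>X. q) * (\<Prod>j\<in>{..<N} - X. ?g j) =
        q ^ card X * (1 - q) ^ (N - card X) * of_bool (\<forall>j\<in>A. j \<in> X)"
      by simp
  qed
  finally show ?thesis ..
qed

text \<open>By independence a monomial in \<open>k\<close> variables has expectation
  \<open>q ^ k\<close>, so the degree does not grow. \<open>q\<close> is complex, although only real
  values are probabilities, because the growth bound below works in the complex plane.\<close>

lemma bernoulli_expectation_poly:
  assumes "multilinear_poly N d f"
  shows "\<exists>p. degree p \<le> d \<and> (\<forall>q. poly p q = bernoulli_expectation N q f)"
  using assms
proof induction
  case (monom A c)
  have "bernoulli_expectation N q (\<lambda>x. c * of_bool (\<forall>j\<in>A. x j)) = poly (Polynomial.monom c (card A)) q" for q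
  proof -
    have "bernoulli_expectation N q (\<lambda>x. c * of_bool (\<forall>j\<in>A. x j)) =
        c * bernoulli_expectation N q (\<lambda>x. of_bool (\<forall>j\<in>A. x j))"
      by (simp add: bernoulli_expectation_def sum_distrib_left mult_ac)
    thus ?thesis using bernoulli_expectation_monom[OF monom(1)] by (simp add: poly_monom)
  qed
  moreover have "degree (Polynomial.monom c (card A)) \<le> d"
    using monom(2) degree_monom_le order_trans by blast
  ultimately show ?case by metis
next
  case (add f g)
  then obtain p p' where "degree p \<le> d" "\<forall>q. poly p q = bernoulli_expectation N q f"
    "degree p' \<le> d" "\<forall>q. poly p' q = bernoulli_expectation N q g" by blast
  thus ?case
    by (intro exI[of _ "p + p'"])
       (auto simp: degree_add_le bernoulli_expectation_def distrib_left sum.distrib)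
qed

lemma binomial_mgf:
  fixes q l :: real
  shows "(\<Sum>X\<in>Pow {..<N}. q ^ card X * (1 - q) ^ (N - card X) * l ^ card X) = (1 - (1 - l) * q) ^ N"
proof -
  have "(1 - (1 - l) * q) ^ N = (\<Prod>j<N. l * q + (1 - q))"
    by (simp add: algebra_simps)
  also have "\<dots> = (\<Sum>X\<in>Pow {..<N}. (\<Prod>j\<in>X. l * q) * (\<Prod>j\<in>{..<N} - X. 1 - q))"
    by (rule prod_add) simp
  also have "\<dots> = (\<Sum>X\<in>Pow {..<N}. q ^ card X * (1 - q) ^ (N - card X) * l ^ card X)"
    by (rule sum.cong[OF refl])
       (auto simp: power_mult_distrib card_Diff_subset finite_subset)
  finally show ?thesis ..
qed

text \<open>Chernoff bound with a fixed tilt \<open>l\<close>: on the tail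
  \<open>l ^ card X * (1 / l) ^ t\<close> is at least \<open>1\<close>, and
  \<open>binomial_mgf\<close> evaluates the tilted sum. The term \<open>t / N / l\<close> in the
  hypothesis pays for the factor \<open>(1 / l) ^ t\<close>, so that only the excess
  \<open>u\<close> remains in the exponent.\<close>

lemma binomial_lower_tail:
  fixes q l u :: real
  assumes l: "0 < l" "l < 1" and q: "0 \<le> q" "q \<le> 1" and N: "0 < N"
    and a: "real t / real N / l + u \<le> q"
  shows "(\<Sum>X | X \<subseteq> {..<N} \<and> card X < t. q ^ card X * (1 - q) ^ (N - card X))
    \<le> exp (- (1 - l) * u * real N)"
proof -
  let ?w = "\<lambda>X :: nat set. q ^ card X * (1 - q) ^ (N - card X)"
  have "(\<Sum>X | X \<subseteq> {..<N} \<and> card X < t. ?w X) \<le> (\<Sum>X | X \<subseteq> {..<N} \<and> card X < t. ?w X * l ^ card X * (1 / l) ^ t)"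
  proof (rule sum_mono)
    fix X assume "X \<in> {X. X \<subseteq> {..<N} \<and> card X < t}"
    hence "l ^ t \<le> l ^ card X"
      using l by (intro power_decreasing) auto
    hence "1 \<le> l ^ card X * (1 / l) ^ t"
      using l by (simp add: power_divide field_simps)
    thus "?w X \<le> ?w X * l ^ card X * (1 / l) ^ t"
      using mult_left_mono[of 1 "l ^ card X * (1 / l) ^ t" "?w X"] q by (simp add: mult_ac)
  qed
  also have "\<dots> \<le> (\<Sum>X\<in>Pow {..<N}. ?w X * l ^ card X * (1 / l) ^ t)"
    using l q by (intro sum_mono2) auto
  also have "\<dots> = (1 / l) ^ t * (1 - (1 - l) * q) ^ N"
    unfolding binomial_mgf[symmetric] sum_distrib_left by (simp add: mult_ac)
  also have "\<dots> \<le> exp (1 / l - 1) ^ t * exp (- ((1 - l) * q)) ^ N"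
  proof (intro mult_mono power_mono)
    have "(1 - l) * q \<le> 1 * 1" using l q by (intro mult_mono) auto
    thus "0 \<le> 1 - (1 - l) * q" by simp
    thus "0 \<le> (1 - (1 - l) * q) ^ N" by simp
    show "1 / l \<le> exp (1 / l - 1)" using exp_ge_add_one_self[of "1 / l - 1"] by simp
    show "1 - (1 - l) * q \<le> exp (- ((1 - l) * q))"
      using exp_ge_add_one_self[of "- ((1 - l) * q)"] by simp
  qed (use l in auto)
  also have "\<dots> = exp ((1 - l) * (real t / l - real N * q))"
    using l by (simp add: exp_of_nat_mult[symmetric] exp_add[symmetric] field_simps)
  also have "\<dots> \<le> exp (- (1 - l) * u * real N)"
  proof -
    have "real t / l + u * real N \<le> real N * q"
      using mult_left_mono[OF a, of "real N"] N by (simp add: field_simps)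
    hence "(1 - l) * (real t / l - real N * q) \<le> (1 - l) * (- (u * real N))"
      using l by (intro mult_left_mono) auto
    thus ?thesis by (simp add: algebra_simps)
  qed
  finally show ?thesis .
qed

text \<open>
  Bernstein--Walsh growth: \<open>w ^ D * p (q w)\<close> is a polynomial in \<open>w\<close>, where \<open>q w\<close> is an affine image of
  the Joukowski map \<open>w + 1 / w\<close>, so the bound on the unit circle extends to the preimage of \<open>0\<close>.
\<close>

lemma poly_bound_extrapolate:
  fixes p :: "complex poly" and a M :: real
  assumes deg: "degree p \<le> D" and a: "0 < a" "a < 1"
    and bound: "\<And>q :: real. a \<le> q \<Longrightarrow> q \<le> 1 \<Longrightarrow> cmod (poly p (of_real q)) \<le> M"
  shows "cmod (poly p 0) \<le> M * ((1 + sqrt a) / (1 - sqrt a)) ^ D"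
proof -
  \<comment> \<open>\<open>g w / w\<close> maps the unit circle onto \<open>[a, 1]\<close>. Clearing
    denominators in \<open>poly p (g w / w)\<close> by \<open>w ^ D\<close> gives \<open>f\<close>,
    which is a polynomial and hence holomorphic at \<open>0\<close> too.\<close>
  define g where "g w = of_real ((1 + a) / 2) * w - of_real ((1 - a) / 4) * (w\<^sup>2 + 1)" for w :: complex
  define f where "f w = (\<Sum>i\<le>degree p. coeff p i * w ^ (D - i) * g w ^ i)" for w
  have f_eq: "f w = w ^ D * poly p (g w / w)" if "w \<noteq> 0" for w
  proof -
    have "coeff p i * w ^ (D - i) * g w ^ i = w ^ D * (coeff p i * (g w / w) ^ i)" if "i \<le> degree p" for i
      using that \<open>w \<noteq> 0\<close> deg by (simp add: power_diff power_divide)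
    thus ?thesis
      unfolding f_def poly_altdef sum_distrib_left by (intro sum.cong) auto
  qed
  have circle: "cmod (f w) \<le> M" if "cmod w = 1" for w
  proof -
    have w0: "w \<noteq> 0" using that by auto
    have ww: "w * cnj w = 1" using complex_norm_square[of w] that by simp
    hence inv: "1 / w = cnj w" using w0 by (simp add: field_simps)
    define q where "q = (1 + a) / 2 - (1 - a) / 2 * Re w"
    have "g w / w = of_real ((1 + a) / 2) - of_real ((1 - a) / 4) * (w + 1 / w)"
      using w0 by (simp add: g_def field_simps power2_eq_square)
    also have "\<dots> = of_real q"
      unfolding inv by (simp add: complex_add_cnj q_def)
    finally have gw: "g w / w = of_real q" .
    have "\<bar>Re w\<bar> \<le> 1" using abs_Re_le_cmod[of w] that by simp
    hence "(1 - a) / 2 * Re w \<le> (1 - a) / 2 * 1" "(1 - a) / 2 * (-1) \<le> (1 - a) / 2 * Re w"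
      using a by (intro mult_left_mono; simp add: abs_le_iff)+
    hence "a \<le> q" "q \<le> 1" by (auto simp: q_def field_simps)
    thus ?thesis
      using bound that by (simp add: f_eq[OF w0] gw norm_mult norm_power)
  qed
  define s where "s = sqrt a"
  have s: "0 < s" "s < 1" "s\<^sup>2 = a" using a by (auto simp: s_def)
  \<comment> \<open>The root of \<open>g\<close> inside the unit disc, where \<open>f\<close> sees
    \<open>poly p 0\<close>; its reciprocal is the base of the growth factor.\<close>
  define w0 where "w0 = (1 - s) / (1 + s)"
  have w0: "0 < w0" "w0 < 1" using s by (auto simp: w0_def field_simps)
  have "(1 + a) / 2 * w0 - (1 - a) / 4 * (w0\<^sup>2 + 1) = 0"
    unfolding s(3)[symmetric] w0_def using s(1,2) by (simp add: power_divide divide_simps) (simp add: power2_eq_square algebra_simps)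
  hence "of_real ((1 + a) / 2 * w0 - (1 - a) / 4 * (w0\<^sup>2 + 1)) = (0 :: complex)"
    by (simp only: of_real_0)
  hence g0: "g (of_real w0) = 0"
    by (simp add: g_def)
  have "cmod (f (of_real w0)) \<le> M"
  proof (rule maximum_modulus_frontier[of f "cball 0 1" M])
    show "f holomorphic_on interior (cball 0 1)"
      unfolding f_def g_def by (intro holomorphic_intros)
    show "continuous_on (closure (cball 0 1)) f"
      unfolding f_def g_def by (intro continuous_intros)
  qed (use circle w0 in \<open>auto simp: dist_norm\<close>)
  moreover have "f (of_real w0) = of_real (w0 ^ D) * poly p 0"
    using w0 by (simp add: f_eq g0)
  ultimately have "w0 ^ D * cmod (poly p 0) \<le> M"
    using w0 by (simp add: norm_mult norm_power)
  hence "cmod (poly p 0) \<le> M / w0 ^ D"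
    using w0 by (simp add: pos_le_divide_eq mult.commute)
  also have "\<dots> = M * ((1 + s) / (1 - s)) ^ D"
    using s by (simp add: w0_def power_divide)
  finally show ?thesis by (simp add: s_def)
qed

section \<open>The error probability as a polynomial in the input bits\<close>

definition search_error :: "nat \<Rightarrow> nat \<Rightarrow> query_algorithm \<Rightarrow> (nat \<Rightarrow> bool) \<Rightarrow> real" where
  "search_error N T A x = (\<Sum>j\<in>{..<N} - solutions N x. output_prob N T A x j)"

lemma search_error_eq:
  assumes "valid_algorithm N T A"
  shows "search_error N T A x =
    (\<Sum>i<2 * N * work_dim A. of_bool (\<not> x (outcome A i)) * (cmod (state N A x T $ i))\<^sup>2)"
proof -
  let ?d = "2 * N * work_dim A"
  let ?J = "{..<N} - solutions N x"
  let ?I = "{i. i < ?d \<and> \<not> x (outcome A i)}"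
  have out: "outcome A i < N" if "i < ?d" for i
    using assms that by (auto simp: valid_algorithm_def Let_def)
  have "search_error N T A x = (\<Sum>j\<in>?J. \<Sum>i | i \<in> ?I \<and> outcome A i = j. (cmod (state N A x T $ i))\<^sup>2)"
    unfolding search_error_def output_prob_def
    by (intro sum.cong) (auto simp: solutions_def)
  also have "\<dots> = (\<Sum>i\<in>?I. (cmod (state N A x T $ i))\<^sup>2)"
    by (rule sum.group) (auto simp: solutions_def out)
  also have "\<dots> = (\<Sum>i<?d. if \<not> x (outcome A i) then (cmod (state N A x T $ i))\<^sup>2 else 0)"
    by (subst sum.inter_filter[symmetric]) (auto intro!: sum.cong)
  also have "\<dots> = (\<Sum>i<?d. of_bool (\<not> x (outcome A i)) * (cmod (state N A x T $ i))\<^sup>2)"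
    by (intro sum.cong) auto
  finally show ?thesis .
qed

lemma search_error_nonneg: "0 \<le> search_error N T A x"
  unfolding search_error_def output_prob_def by (intro sum_nonneg) auto

lemma state_carrier:
  assumes "valid_algorithm N T A" "k \<le> T"
  shows "state N A x k \<in> carrier_vec (2 * N * work_dim A)"
  using assms(2)
proof (induction k)
  case 0
  thus ?case using assms(1)
    by (auto simp: valid_algorithm_def Let_def unitary_def intro!: mult_mat_vec_carrier)
next
  case (Suc k)
  have "gate A (Suc k) \<in> carrier_mat (2 * N * work_dim A) (2 * N * work_dim A)"
    using assms(1) Suc by (auto simp: valid_algorithm_def Let_def unitary_def)
  thus ?case using Suc
    by (auto intro!: mult_mat_vec_carrier query_gate_carrier)
qed

lemma sq_norm_state:
  assumes valid: "valid_algorithm N T A" and "0 < N" and "k \<le> T"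
  shows "sq_norm_vec (state N A x k) = 1"
  using assms(3)
proof (induction k)
  case 0
  have "unitary (2 * N * work_dim A) (gate A 0)" "start A \<in> carrier_vec (2 * N * work_dim A)"
    "start A \<bullet>c start A = 1"
    using valid by (auto simp: valid_algorithm_def Let_def)
  thus ?case
    by (simp add: sq_norm_vec_unitary cscalar_prod_self)
next
  case (Suc k)
  have U: "unitary (2 * N * work_dim A) (gate A (Suc k))"
    using valid Suc by (auto simp: valid_algorithm_def Let_def)
  have v: "state N A x k \<in> carrier_vec (2 * N * work_dim A)"
    using valid Suc by (intro state_carrier) auto
  have "query_gate N (work_dim A) x *\<^sub>v state N A x k \<in> carrier_vec (2 * N * work_dim A)"
    using v by (auto intro!: mult_mat_vec_carrier query_gate_carrier)
  thus ?case
    using Suc by (simp add: sq_norm_vec_unitary[OF U] sq_norm_vec_query_gate[OF \<open>0 < N\<close> v])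
qed

lemma multilinear_poly_mult_mat_vec:
  assumes "U \<in> carrier_mat n n" "\<And>x. v x \<in> carrier_vec n"
    and "\<And>c. c < n \<Longrightarrow> multilinear_poly N d (\<lambda>x. v x $ c)" and "i < n"
  shows "multilinear_poly N d (\<lambda>x. (U *\<^sub>v v x) $ i)"
proof -
  have eq: "(U *\<^sub>v v x) $ i = (\<Sum>c<n. U $$ (i, c) * v x $ c)" for x
    using assms(1,4) carrier_vecD[OF assms(2)]
    by (auto simp: scalar_prod_def atLeast0LessThan intro!: sum.cong)
  show ?thesis
    unfolding eq using multilinear_poly_mult[OF multilinear_poly_const[of N 0] assms(3)]
    by (intro multilinear_poly_sum) auto
qed

text \<open>A query replaces the amplitude \<open>f0\<close> of a basis state by
  \<open>f0 + x j * (f1 - f0)\<close>, where \<open>f1\<close> belongs to the state with the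
  opposite target bit; this raises the degree by one. The unitaries in between only form linear
  combinations.\<close>

lemma multilinear_poly_state:
  assumes valid: "valid_algorithm N T A" and N: "0 < N" and "k \<le> T" "i < 2 * N * work_dim A"
  shows "multilinear_poly N k (\<lambda>x. state N A x k $ i)"
  using assms(3,4)
proof (induction k arbitrary: i)
  case 0
  show ?case by (simp add: multilinear_poly_const)
next
  case (Suc k)
  let ?W = "work_dim A" let ?d = "2 * N * ?W"
  have v: "state N A x k \<in> carrier_vec ?d" for x
    using valid Suc by (intro state_carrier) auto
  have U: "gate A (Suc k) \<in> carrier_mat ?d ?d"
    using valid Suc by (auto simp: valid_algorithm_def Let_def unitary_def)
  have "multilinear_poly N (Suc k) (\<lambda>x. (query_gate N ?W x *\<^sub>v state N A x k) $ c)" if c: "c < ?d" for c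
  proof -
    obtain j b w where r: "registers N c = (j, b, w)" by (metis prod_cases3)
    have rs: "(j, b, w) \<in> register_set N ?W" using registers_in_register_set[OF c] r by simp
    hence j: "j < N" and rs': "(j, \<not> b, w) \<in> register_set N ?W" by (auto simp: register_set_def)
    have c_eq: "c = basis_index N (j, b, w)" using basis_index_registers[OF N, of c] r by simp
    define f0 f1 where "f0 x = state N A x k $ basis_index N (j, b, w)"
      and "f1 x = state N A x k $ basis_index N (j, \<not> b, w)" for x
    have "(query_gate N ?W x *\<^sub>v state N A x k) $ c = f0 x + of_bool (x j) * (f1 x + (-1) * f0 x)" for x
      unfolding c_eq query_gate_amplitude[OF rs v]
      by (cases "x j") (auto simp: flip_target_def f0_def f1_def)
    moreover have f: "multilinear_poly N k f0" "multilinear_poly N k f1"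
      unfolding f0_def f1_def using Suc basis_index_less[OF rs] basis_index_less[OF rs'] by auto
    have g: "multilinear_poly N k (\<lambda>x. f1 x + (-1) * f0 x)"
      using multilinear_poly_mult[OF multilinear_poly_const[of N 0 "-1"] f(1)] f(2)
      by (intro multilinear_poly.add) auto
    have "multilinear_poly N (Suc k) (\<lambda>x. f0 x + of_bool (x j) * (f1 x + (-1) * f0 x))"
      using multilinear_poly_mono[OF f(1), of "Suc k"] multilinear_poly_mult[OF multilinear_poly_var[OF j] g]
      by (intro multilinear_poly.add) auto
    ultimately show ?thesis by simp
  qed
  moreover have "query_gate N ?W x *\<^sub>v state N A x k \<in> carrier_vec ?d" for x
    using v by (auto intro!: mult_mat_vec_carrier query_gate_carrier)
  ultimately show ?case
    using Suc.prems by (simp only: state.simps) (intro multilinear_poly_mult_mat_vec[OF U], auto)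
qed

text \<open>The squared modulus contributes \<open>2 * T\<close>; the additional \<open>1\<close> is
  the bit of the reported index, which decides whether the outcome is an error.\<close>

lemma multilinear_poly_search_error:
  assumes valid: "valid_algorithm N T A" and N: "0 < N"
  shows "multilinear_poly N (2 * T + 1) (\<lambda>x. of_real (search_error N T A x))"
proof -
  let ?s = "\<lambda>i x. state N A x T $ i"
  have out: "outcome A i < N" if "i < 2 * N * work_dim A" for i
    using valid that by (auto simp: valid_algorithm_def Let_def)
  have eq: "of_real (search_error N T A x) =
      (\<Sum>i<2 * N * work_dim A. (1 + (-1) * of_bool (x (outcome A i))) * (?s i x * cnj (?s i x)))" for x
    unfolding search_error_eq[OF valid] of_real_sum
    by (intro sum.cong) (auto simp: complex_norm_square simp del: of_real_power)
  have "multilinear_poly N (1 + (T + T)) (\<lambda>x. (1 + (-1) * of_bool (x (outcome A i))) * (?s i x * cnj (?s i x)))"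
    if i: "i < 2 * N * work_dim A" for i
  proof (intro multilinear_poly_mult multilinear_poly_cnj)
    show "multilinear_poly N T (?s i)"
      using multilinear_poly_state[OF valid N _ i] by simp
    thus "multilinear_poly N T (?s i)" .
    show "multilinear_poly N 1 (\<lambda>x. 1 + (-1) * of_bool (x (outcome A i)))"
      using multilinear_poly_mult[OF multilinear_poly_const[of N 0 "-1"] multilinear_poly_var[OF out[OF i]]]
      by (intro multilinear_poly.add multilinear_poly_const) simp
  qed
  thus ?thesis
    unfolding eq using multilinear_poly_sum[of "{..<2 * N * work_dim A}"]
    by (simp add: mult_2)
qed

lemma search_error_le_1:
  assumes valid: "valid_algorithm N T A" and N: "0 < N"
  shows "search_error N T A x \<le> 1"
proof -
  have "search_error N T A x \<le> (\<Sum>i<2 * N * work_dim A. (cmod (state N A x T $ i))\<^sup>2)"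
    unfolding search_error_eq[OF valid] by (intro sum_mono) (auto simp: of_bool_def)
  also have "\<dots> = 1"
    using sq_norm_state[OF valid N, of T x] carrier_vecD[OF state_carrier[OF valid, of T x]]
    by (simp add: sq_norm_vec_def)
  finally show ?thesis .
qed

lemma search_error_no_solutions:
  assumes valid: "valid_algorithm N T A" and N: "0 < N"
  shows "search_error N T A (\<lambda>_. False) = 1"
  using sq_norm_state[OF valid N, of T "\<lambda>_. False"] carrier_vecD[OF state_carrier[OF valid, of T "\<lambda>_. False"]]
  unfolding search_error_eq[OF valid] by (simp add: sq_norm_vec_def)

lemma search_error_tradeoff:
  fixes l u \<epsilon> :: real
  assumes valid: "valid_algorithm N T A" and err: "search_error_le N t T A \<epsilon>" and N: "0 < N"
    and l: "0 < l" "l < 1" and a: "a = real t / real N / l + u" "0 < a" "a < 1" and eps: "0 \<le> \<epsilon>"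
  shows "1 \<le> (\<epsilon> + exp (- (1 - l) * u * real N)) * ((1 + sqrt a) / (1 - sqrt a)) ^ (2 * T + 1)"
proof -
  let ?f = "search_error N T A"
  obtain p where p: "degree p \<le> 2 * T + 1"
    "\<And>q. poly p q = bernoulli_expectation N q (\<lambda>x. of_real (?f x))"
    using bernoulli_expectation_poly[OF multilinear_poly_search_error[OF valid N]] by blast
  have at_0: "poly p 0 = 1"
  proof -
    \<comment> \<open>At \<open>q = 0\<close> all weight sits on the empty set, as
      \<open>0 ^ 0 = 1\<close>, so the input has no solution.\<close>
    have "poly p 0 = (\<Sum>X\<in>{{}}. 0 ^ card X * (1 - 0) ^ (N - card X) * of_real (?f (\<lambda>j. j \<in> X)))"
      unfolding p bernoulli_expectation_def
      by (rule sum.mono_neutral_right) (auto simp: power_0_left card_eq_0_iff finite_subset)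
    thus ?thesis by (simp add: search_error_no_solutions[OF valid N])
  qed
  have "cmod (poly p (of_real q)) \<le> \<epsilon> + exp (- (1 - l) * u * real N)" if q: "a \<le> q" "q \<le> 1" for q :: real
  proof -
    let ?w = "\<lambda>X :: nat set. q ^ card X * (1 - q) ^ (N - card X)"
    have w0: "0 \<le> ?w X" for X using q a by auto
    have w1: "(\<Sum>X\<in>Pow {..<N}. ?w X) = 1"
      using binomial_mgf[of q N 1] by simp
    have "poly p (of_real q) = of_real (\<Sum>X\<in>Pow {..<N}. ?w X * ?f (\<lambda>j. j \<in> X))"
      by (simp add: p bernoulli_expectation_def)
    moreover have "0 \<le> (\<Sum>X\<in>Pow {..<N}. ?w X * ?f (\<lambda>j. j \<in> X))"
      by (intro sum_nonneg mult_nonneg_nonneg[OF w0] search_error_nonneg)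
    ultimately have "cmod (poly p (of_real q)) = (\<Sum>X\<in>Pow {..<N}. ?w X * ?f (\<lambda>j. j \<in> X))"
      by (simp del: of_real_sum)
    \<comment> \<open>The promise controls the error only from \<open>t\<close> solutions on; below
      that the trivial bound \<open>1\<close> leaves the probability of the tail.\<close>
    also have "\<dots> \<le> (\<Sum>X\<in>Pow {..<N}. \<epsilon> * ?w X + (if card X < t then ?w X else 0))"
    proof (rule sum_mono)
      fix X assume X: "X \<in> Pow {..<N}"
      have sol: "solutions N (\<lambda>j. j \<in> X) = X" using X by (auto simp: solutions_def)
      show "?w X * ?f (\<lambda>j. j \<in> X) \<le> \<epsilon> * ?w X + (if card X < t then ?w X else 0)"
      proof (cases "card X < t")
        case True
        have "?w X * ?f (\<lambda>j. j \<in> X) \<le> ?w X * 1"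
          using w0 search_error_le_1[OF valid N] by (intro mult_left_mono) auto
        thus ?thesis using True eps w0[of X] by (simp add: add_increasing)
      next
        case False
        hence "?f (\<lambda>j. j \<in> X) \<le> \<epsilon>"
          using err[unfolded search_error_le_def, rule_format, of "\<lambda>j. j \<in> X"]
          by (simp add: sol search_error_def)
        thus ?thesis using False mult_left_mono[OF _ w0[of X]] by (simp add: mult.commute)
      qed
    qed
    also have "\<dots> = \<epsilon> + (\<Sum>X | X \<subseteq> {..<N} \<and> card X < t. ?w X)"
      by (simp add: sum.distrib sum_distrib_left[symmetric] w1[unfolded Pow_def] sum.inter_filter[symmetric] Pow_def)
    also have "\<dots> \<le> \<epsilon> + exp (- (1 - l) * u * real N)"
      using binomial_lower_tail[of l q N t u] l q a N by simp
    finally show ?thesis .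
  qed
  from poly_bound_extrapolate[OF p(1) a(2,3) this] show ?thesis
    by (simp add: at_0)
qed

text \<open>Averaging: starting from the whole of \<open>{..<N}\<close> and going down, remove each
  time an element of at least average weight; the average of the rest never increases.\<close>

lemma exists_light_subset:
  fixes \<pi> :: "nat \<Rightarrow> real"
  assumes "t \<le> N" "\<And>j. j < N \<Longrightarrow> 0 \<le> \<pi> j"
  shows "\<exists>X\<subseteq>{..<N}. card X = t \<and> real N * sum \<pi> X \<le> real t * sum \<pi> {..<N}"
  using assms(1)
proof (induction rule: inc_induct)
  case base
  show ?case by (intro exI[of _ "{..<N}"]) auto
next
  case (step n)
  then obtain X where X: "X \<subseteq> {..<N}" "card X = Suc n"
    "real N * sum \<pi> X \<le> real (Suc n) * sum \<pi> {..<N}" by blast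
  have fin: "finite X" using X finite_subset by blast
  have "\<exists>m\<in>X. sum \<pi> X \<le> real (Suc n) * \<pi> m"
  proof (rule ccontr)
    assume *: "\<not> ?thesis"
    have "X \<noteq> {}" using X by auto
    hence "(\<Sum>m\<in>X. real (Suc n) * \<pi> m) < (\<Sum>m\<in>X. sum \<pi> X)"
      using * fin by (intro sum_strict_mono) (auto simp: not_le)
    thus False using X by (simp add: sum_distrib_left[symmetric])
  qed
  then obtain m where m: "m \<in> X" "sum \<pi> X \<le> real (Suc n) * \<pi> m" by blast
  have "real (Suc n) * sum \<pi> (X - {m}) \<le> real n * sum \<pi> X"
    using m fin by (simp add: sum_diff1 algebra_simps)
  hence "real N * (real (Suc n) * sum \<pi> (X - {m})) \<le> real N * (real n * sum \<pi> X)"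
    by (intro mult_left_mono) auto
  also have "\<dots> \<le> real n * (real (Suc n) * sum \<pi> {..<N})"
    using mult_left_mono[OF X(3), of "real n"] by (simp add: mult_ac)
  finally have "real (Suc n) * (real N * sum \<pi> (X - {m})) \<le> real (Suc n) * (real n * sum \<pi> {..<N})"
    by (simp only: mult_ac)
  hence "real N * sum \<pi> (X - {m}) \<le> real n * sum \<pi> {..<N}"
    by (rule mult_left_le_imp_le) simp
  thus ?case using X m fin by (intro exI[of _ "X - {m}"]) auto
qed

text \<open>Without a query the output distribution does not depend on the input, and an adversary
  places the \<open>t\<close> solutions where it has least mass.\<close>

lemma search_needs_query:
  assumes valid: "valid_algorithm N T A" and err: "search_error_le N t T A \<epsilon>" and N: "0 < N"
    and t: "t \<le> N" and eps: "\<epsilon> < 1 - real t / real N"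
  shows "0 < T"
proof (rule ccontr)
  assume "\<not> 0 < T"
  hence T: "T = 0" by simp
  define \<pi> where "\<pi> j = output_prob N T A (\<lambda>_. False) j" for j
  have indep: "output_prob N T A x j = \<pi> j" for x j
    by (simp add: \<pi>_def output_prob_def T)
  have total: "sum \<pi> {..<N} = 1"
    using search_error_no_solutions[OF valid N] by (simp add: search_error_def solutions_def \<pi>_def)
  have "0 \<le> \<pi> j" for j by (auto simp: \<pi>_def output_prob_def intro: sum_nonneg)
  with exists_light_subset[OF t, of \<pi>] total obtain X
    where X: "X \<subseteq> {..<N}" "card X = t" "real N * sum \<pi> X \<le> real t" by auto
  have sol: "solutions N (\<lambda>j. j \<in> X) = X" using X by (auto simp: solutions_def)
  have "sum \<pi> ({..<N} - X) \<le> \<epsilon>"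
    using err[unfolded search_error_le_def, rule_format, of "\<lambda>j. j \<in> X"] X by (simp add: sol indep)
  moreover have "sum \<pi> ({..<N} - X) = 1 - sum \<pi> X"
    using X total by (simp add: sum_diff)
  moreover have "sum \<pi> X \<le> real t / real N"
    using X N by (simp add: field_simps)
  ultimately show False using eps by simp
qed

subsection \<open>The lower bound on the number of queries\<close>

lemma growth_le_exp:
  fixes s :: real
  assumes "0 \<le> s" "s < 1"
  shows "((1 + s) / (1 - s)) ^ D \<le> exp (real D * (2 * s / (1 - s)))"
proof -
  have "(1 + s) / (1 - s) = 1 + 2 * s / (1 - s)"
    using assms by (simp add: field_simps)
  also have "\<dots> \<le> exp (2 * s / (1 - s))"
    by (rule exp_ge_add_one_self)
  finally have "((1 + s) / (1 - s)) ^ D \<le> exp (2 * s / (1 - s)) ^ D"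
    using assms by (intro power_mono) auto
  thus ?thesis
    by (simp only: exp_of_nat_mult)
qed

text \<open>From \<open>1 \<le> T\<close> the degree \<open>2 * T + 1\<close> is at most
  \<open>3 * T\<close>; together with the \<open>2\<close> of \<open>growth_le_exp\<close> this
  gives the \<open>6\<close>.\<close>

lemma search_error_tradeoff_exp:
  fixes l u \<epsilon> b :: real
  assumes valid: "valid_algorithm N T A" and err: "search_error_le N t T A \<epsilon>" and N: "0 < N"
    and l: "0 < l" "l < 1" and a: "a = real t / real N / l + u" "0 < a" "a < 1" and eps: "0 \<le> \<epsilon>"
    and T: "1 \<le> T" and b: "0 < b" "b \<le> 1 - sqrt a"
  shows "1 \<le> (\<epsilon> + exp (- (1 - l) * u * real N)) * exp (6 / b * (real T * sqrt a))"
proof -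
  have s: "0 \<le> sqrt a" "sqrt a < 1" using a by auto
  have "1 \<le> (\<epsilon> + exp (- (1 - l) * u * real N)) * ((1 + sqrt a) / (1 - sqrt a)) ^ (2 * T + 1)"
    by (rule search_error_tradeoff[OF valid err N l a eps])
  also have "\<dots> \<le> (\<epsilon> + exp (- (1 - l) * u * real N)) * exp (6 / b * (real T * sqrt a))"
  proof (intro mult_left_mono order_trans[OF growth_le_exp[OF s]])
    have "2 * sqrt a / (1 - sqrt a) \<le> 2 * sqrt a / b"
      using s b by (intro divide_left_mono) auto
    hence "real (2 * T + 1) * (2 * sqrt a / (1 - sqrt a)) \<le> (3 * real T) * (2 * sqrt a / b)"
      using s T by (intro mult_mono) auto
    also have "\<dots> = 6 / b * (real T * sqrt a)" by simp
    finally show "exp (real (2 * T + 1) * (2 * sqrt a / (1 - sqrt a))) \<le> exp (6 / b * (real T * sqrt a))"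
      by simp
  qed (use eps in \<open>simp add: add_nonneg_nonneg\<close>)
  finally show ?thesis .
qed

text \<open>The general bound below loses an additive \<open>ln 2\<close>, coming from a sum of two
  exponentials. This bound, taken with \<open>u\<close> proportional to \<open>t / N\<close>, allows
  that loss to be absorbed.\<close>

lemma search_constant_lower_bound:
  fixes \<epsilon>0 :: real
  assumes "0 < \<epsilon>0" "\<epsilon>0 < 1"
  shows "\<exists>c>0. \<forall>N t T A \<epsilon>. valid_algorithm N T A \<longrightarrow> search_error_le N t T A \<epsilon> \<longrightarrow> 0 < N \<longrightarrow>
    1 \<le> t \<longrightarrow> 1 \<le> T \<longrightarrow> 0 \<le> \<epsilon> \<longrightarrow> \<epsilon> \<le> \<epsilon>0 \<longrightarrow> c \<le> real T * sqrt (real t / real N)"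
proof -
  \<comment> \<open>With \<open>l = 1 / 2\<close> and \<open>u = K * t / N\<close> the tail is at
    most \<open>(1 - \<epsilon>0) / 2\<close> for every \<open>t \<ge> 1\<close>, so
    \<open>\<epsilon>\<close> plus the tail stays below
    \<open>(1 + \<epsilon>0) / 2 < 1\<close>.\<close>
  define K where "K = 2 * ln (2 / (1 - \<epsilon>0))"
  have K: "0 < K" using assms by (simp add: K_def)
  define c1 where "c1 = 1 / (2 * sqrt (2 + K))"
  define c2 where "c2 = ln (2 / (1 + \<epsilon>0)) / (12 * sqrt (2 + K))"
  have c: "0 < c1" "0 < c2" using K assms by (auto simp: c1_def c2_def)
  have "min c1 c2 \<le> real T * sqrt (real t / real N)"
    if valid: "valid_algorithm N T A" and err: "search_error_le N t T A \<epsilon>" and N: "0 < N"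
      and t: "1 \<le> t" and T: "1 \<le> T" and eps: "0 \<le> \<epsilon>" "\<epsilon> \<le> \<epsilon>0" for N t T A \<epsilon>
  proof -
    define \<tau> where "\<tau> = real t / real N"
    define a where "a = (2 + K) * \<tau>"
    have \<tau>: "0 < \<tau>" using N t by (simp add: \<tau>_def)
    have sa: "sqrt a = sqrt (2 + K) * sqrt \<tau>" by (simp add: a_def real_sqrt_mult)
    show ?thesis
    proof (cases "a < 1 / 4")
      \<comment> \<open>Here \<open>t / N\<close> is bounded below by a constant, and a single query
        is enough for the claim.\<close>
      case False
      hence "sqrt (1 / 4) \<le> sqrt a" by (intro real_sqrt_le_mono) auto
      hence "1 / 2 \<le> sqrt (2 + K) * sqrt \<tau>" by (simp add: sa real_sqrt_divide)
      hence "c1 \<le> 1 * sqrt \<tau>" using K by (simp add: c1_def field_simps)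
      also have "\<dots> \<le> real T * sqrt \<tau>" using T \<tau> by (intro mult_right_mono) auto
      finally show ?thesis by (simp add: \<tau>_def min.coboundedI1)
    next
      case True
      hence "sqrt a < sqrt (1 / 4)" by (intro real_sqrt_less_mono) auto
      hence b: "1 / 2 \<le> 1 - sqrt a" by (simp add: real_sqrt_divide)
      have "a = real t / real N / (1 / 2) + K * \<tau>"
        by (simp add: a_def \<tau>_def algebra_simps add_divide_distrib)
      moreover have "0 < a" using K \<tau> by (simp add: a_def)
      ultimately have "1 \<le> (\<epsilon> + exp (- (1 - 1 / 2) * (K * \<tau>) * real N)) * exp (6 / (1 / 2) * (real T * sqrt a))"
        using True b by (intro search_error_tradeoff_exp[OF valid err N]) (use eps T in auto)
      also have "\<dots> \<le> ((1 + \<epsilon>0) / 2) * exp (12 * (real T * sqrt a))"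
      proof (intro mult_mono)
        have "K * 1 \<le> K * real t" using K t by (intro mult_left_mono) auto
        hence "- (1 - 1 / 2) * (K * \<tau>) * real N \<le> - ln (2 / (1 - \<epsilon>0))"
          using N by (simp add: \<tau>_def K_def)
        hence "exp (- (1 - 1 / 2) * (K * \<tau>) * real N) \<le> exp (- ln (2 / (1 - \<epsilon>0)))"
          by (simp only: exp_le_cancel_iff)
        also have "\<dots> = (1 - \<epsilon>0) / 2" using assms by (simp add: exp_minus)
        finally show "\<epsilon> + exp (- (1 - 1 / 2) * (K * \<tau>) * real N) \<le> (1 + \<epsilon>0) / 2"
          using eps by (simp add: field_simps)
      qed (use assms in auto)
      finally have "2 / (1 + \<epsilon>0) \<le> exp (12 * (real T * sqrt a))"
        using assms by (simp add: field_simps)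
      hence "ln (2 / (1 + \<epsilon>0)) \<le> ln (exp (12 * (real T * sqrt a)))"
        using assms by (subst ln_le_cancel_iff) auto
      hence "c2 \<le> real T * sqrt \<tau>"
        using K by (simp add: c2_def sa field_simps)
      thus ?thesis by (simp add: \<tau>_def min.coboundedI2)
    qed
  qed
  moreover have "0 < min c1 c2" using c by simp
  ultimately show ?thesis by blast
qed

lemma search_lower_bound:
  fixes \<eta> \<epsilon>0 :: real
  assumes \<eta>: "0 < \<eta>" "\<eta> < 1" and \<epsilon>0: "0 < \<epsilon>0" "\<epsilon>0 < 1"
  shows "\<exists>C>0. \<forall>N t T A \<epsilon>. (N, t, \<epsilon>) \<in> search_params \<eta> \<epsilon>0 \<longrightarrow> valid_algorithm N T A \<longrightarrow>
    search_error_le N t T A \<epsilon> \<longrightarrow>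
    log 2 (1 / \<epsilon>) \<le> C * ((real T)\<^sup>2 / real N + real T * sqrt (real t / real N))"
proof -
  obtain c1 where c1: "0 < c1" and const: "\<And>N t T A \<epsilon>. valid_algorithm N T A \<Longrightarrow>
    search_error_le N t T A \<epsilon> \<Longrightarrow> 0 < N \<Longrightarrow> 1 \<le> t \<Longrightarrow> 1 \<le> T \<Longrightarrow> 0 \<le> \<epsilon> \<Longrightarrow> \<epsilon> \<le> \<epsilon>0 \<Longrightarrow>
    c1 \<le> real T * sqrt (real t / real N)"
    using search_constant_lower_bound[OF \<epsilon>0] by blast
  \<comment> \<open>This tilt gives \<open>t / N / l \<le> l\<close>. Of the remaining room
    \<open>h\<close> up to \<open>1\<close>, the excess \<open>u\<close> takes at most half, which
    keeps \<open>a\<close> away from \<open>1\<close>.\<close>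
  define l where "l = sqrt \<eta>"
  define h where "h = 1 - l"
  have l: "0 < l" "l < 1" "l\<^sup>2 = \<eta>" using \<eta> by (auto simp: l_def)
  have h: "0 < h" "h < 1" using l by (auto simp: h_def)
  \<comment> \<open>The tail exponent \<open>(1 - l) * u * N\<close> will equal
    \<open>c * L\<close>, so the tail is at most \<open>\<epsilon> powr c\<close>.\<close>
  define c where "c = h\<^sup>2 / 2"
  have c: "0 < c" "c \<le> 1" using h power_le_one[of h 2] by (auto simp: c_def)
  define \<kappa> where "\<kappa> = 24 / h * sqrt (h / 2)"
  define C1 where "C1 = ln 2 / c1 + 24 / h / sqrt l"
  define C2 where "C2 = \<kappa>\<^sup>2 / (2 * c)"
  have C: "0 < C1" "0 \<le> C2" using c1 h l c by (auto simp: C1_def C2_def intro!: add_pos_nonneg)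
  have main: "c / 2 * ln (1 / \<epsilon>) \<le> C1 * (real T * sqrt (real t / real N)) + C2 * ((real T)\<^sup>2 / real N)"
    if par: "(N, t, \<epsilon>) \<in> search_params \<eta> \<epsilon>0" and valid: "valid_algorithm N T A"
      and err: "search_error_le N t T A \<epsilon>" for N t T A \<epsilon>
  proof -
    have N: "0 < N" and t: "1 \<le> t" "real t \<le> \<eta> * real N" and eps: "1 / 2 ^ N \<le> \<epsilon>" "\<epsilon> \<le> \<epsilon>0"
      "\<epsilon> < 1 - real t / real N"
      using par by (auto simp: search_params_def)
    have eps0: "0 < \<epsilon>" using eps(1) by (meson less_le_trans zero_less_divide_1_iff zero_less_numeral zero_less_power)
    have "\<eta> * real N \<le> 1 * real N" using \<eta> by (intro mult_right_mono) auto
    hence tN: "t \<le> N" using t by simp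
    have T: "1 \<le> T" using search_needs_query[OF valid err N tN eps(3)] by simp
    define L where "L = ln (1 / \<epsilon>)"
    have L0: "0 < L" using eps \<epsilon>0 eps0 by (simp add: L_def)
    have "1 / \<epsilon> \<le> 2 ^ N" using eps(1) eps0 by (simp add: field_simps)
    hence "L \<le> ln (2 ^ N)" using eps0 by (simp add: L_def)
    also have "\<dots> = real N * ln 2" by (simp add: ln_realpow)
    also have "\<dots> \<le> real N * 1" using ln_2_less_1 by (intro mult_left_mono) auto
    finally have LN: "L / real N \<le> 1" using N by simp
    define \<tau> where "\<tau> = real t / real N"
    define u where "u = h / 2 * (L / real N)"
    define a where "a = real t / real N / l + u"
    have u: "0 < u" "u \<le> h / 2"
      using h L0 N LN mult_left_mono[OF LN, of "h / 2"] by (auto simp: u_def)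
    have \<tau>: "0 < \<tau>" "\<tau> \<le> l\<^sup>2" using N t l by (auto simp: \<tau>_def field_simps)
    have "\<tau> / l \<le> l" using \<tau> l by (simp add: field_simps power2_eq_square)
    moreover have "0 < \<tau> / l" using \<tau> l by simp
    ultimately have a: "0 < a" "a \<le> 1 - h / 2"
      unfolding a_def \<tau>_def[symmetric] using u h_def by linarith+
    \<comment> \<open>Expanding the square gives \<open>1 - sqrt a \<ge> (1 - a) / 2\<close>, and
      \<open>1 - a\<close> is at least \<open>h / 2\<close>.\<close>
    have "0 \<le> (1 - sqrt a)\<^sup>2" by simp
    hence "2 * sqrt a \<le> 1 + a" using a by (simp add: power2_diff)
    hence b: "h / 4 \<le> 1 - sqrt a" using a by simp
    have "1 \<le> (\<epsilon> + exp (- (1 - l) * u * real N)) * exp (6 / (h / 4) * (real T * sqrt a))"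
      by (rule search_error_tradeoff_exp[OF valid err N l(1,2) a_def a(1)])
         (use a h eps0 T b in auto)
    also have "\<dots> \<le> (2 * exp (- c * L)) * exp (6 / (h / 4) * (real T * sqrt a))"
    proof (intro mult_right_mono)
      have "\<epsilon> = exp (- L)" using eps0 by (simp add: L_def ln_div)
      also have "\<dots> \<le> exp (- c * L)" using c L0 by simp
      finally have "\<epsilon> \<le> exp (- c * L)" .
      moreover have "- (1 - l) * u * real N = - c * L"
      proof -
        have uN: "u * real N = h / 2 * L" using N by (simp add: u_def)
        have "- (1 - l) * u * real N = - (h * (u * real N))" by (simp only: h_def mult.assoc minus_mult_left)
        also have "\<dots> = - c * L" unfolding uN by (simp add: c_def power2_eq_square)
        finally show ?thesis .
      qed
      ultimately show "\<epsilon> + exp (- (1 - l) * u * real N) \<le> 2 * exp (- c * L)" by simp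
    qed auto
    also have "\<dots> = 2 * exp (24 / h * (real T * sqrt a) - c * L)"
      by (simp add: exp_diff exp_minus field_simps)
    finally have "exp (- ln 2) \<le> exp (24 / h * (real T * sqrt a) - c * L)"
      by (simp add: exp_minus field_simps)
    hence 1: "c * L \<le> ln 2 + 24 / h * (real T * sqrt a)" by simp
    \<comment> \<open>Splitting the root separates the two terms of the claim:
      \<open>T * sqrt (t / N)\<close> directly, and \<open>T * sqrt (L / N)\<close>, which still
      contains \<open>L\<close>.\<close>
    have "sqrt a \<le> sqrt (\<tau> / l) + sqrt u"
      unfolding a_def \<tau>_def[symmetric] using \<tau> l u by (intro sqrt_add_le_add_sqrt) auto
    hence "24 / h * (real T * sqrt a) \<le> 24 / h * (real T * (sqrt (\<tau> / l) + sqrt u))"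
      using h by (intro mult_left_mono) auto
    also have "\<dots> = 24 / h / sqrt l * (real T * sqrt \<tau>) + \<kappa> * (real T / sqrt (real N)) * sqrt L"
      by (simp add: u_def \<kappa>_def real_sqrt_divide real_sqrt_mult algebra_simps)
    finally have 2: "24 / h * (real T * sqrt a) \<le>
        24 / h / sqrt l * (real T * sqrt \<tau>) + \<kappa> * (real T / sqrt (real N)) * sqrt L" .
    define y where "y = \<kappa> * (real T / sqrt (real N))"
    have y2: "y\<^sup>2 = \<kappa>\<^sup>2 * ((real T)\<^sup>2 / real N)"
      using N by (simp add: y_def power_mult_distrib power_divide)
    \<comment> \<open>Weighted arithmetic-geometric mean: \<open>y * sqrt L\<close> is bounded by a
      multiple of \<open>T\<^sup>2 / N\<close> plus \<open>c / 2 * L\<close>, which is half of the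
      left-hand side \<open>c * L\<close> and can be subtracted.\<close>
    have "0 \<le> (y - c * sqrt L)\<^sup>2" by simp
    hence "2 * c * (y * sqrt L) \<le> y\<^sup>2 + c\<^sup>2 * L"
      using L0 by (simp add: power2_diff power_mult_distrib mult_ac)
    hence "y * sqrt L \<le> (y\<^sup>2 + c\<^sup>2 * L) / (2 * c)"
      using c by (simp add: field_simps)
    also have "\<dots> = C2 * ((real T)\<^sup>2 / real N) + c / 2 * L"
    proof -
      have "(y\<^sup>2 + c\<^sup>2 * L) / (2 * c) = y\<^sup>2 / (2 * c) + c / 2 * L"
        using c by (simp add: add_divide_distrib power2_eq_square[of c])
      moreover have "y\<^sup>2 / (2 * c) = C2 * ((real T)\<^sup>2 / real N)"
        unfolding y2 C2_def by simp
      ultimately show ?thesis by simp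
    qed
    finally have 3: "y * sqrt L \<le> C2 * ((real T)\<^sup>2 / real N) + c / 2 * L" .
    \<comment> \<open>Absorbs the additive \<open>ln 2\<close> into the linear term.\<close>
    have "c1 \<le> real T * sqrt \<tau>"
      unfolding \<tau>_def by (rule const[OF valid err N t(1) T _ eps(2)]) (use eps0 in auto)
    hence "ln 2 / c1 * c1 \<le> ln 2 / c1 * (real T * sqrt \<tau>)"
      using c1 by (intro mult_left_mono) auto
    hence 4: "ln 2 \<le> ln 2 / c1 * (real T * sqrt \<tau>)" using c1 by simp
    have "c / 2 * L \<le> C1 * (real T * sqrt \<tau>) + C2 * ((real T)\<^sup>2 / real N)"
      using 1 2 3 4 unfolding C1_def y_def[symmetric] distrib_right by linarith
    thus ?thesis by (simp add: L_def \<tau>_def)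
  qed
  define C where "C = 2 / (c * ln 2) * max C1 C2"
  have "log 2 (1 / \<epsilon>) \<le> C * ((real T)\<^sup>2 / real N + real T * sqrt (real t / real N))"
    if "(N, t, \<epsilon>) \<in> search_params \<eta> \<epsilon>0" "valid_algorithm N T A" "search_error_le N t T A \<epsilon>" for N t T A \<epsilon>
  proof -
    let ?x = "real T * sqrt (real t / real N)" and ?y = "(real T)\<^sup>2 / real N"
    have "c / 2 * ln (1 / \<epsilon>) \<le> max C1 C2 * ?x + max C1 C2 * ?y"
      by (rule order_trans[OF main[OF that]]) (intro add_mono mult_right_mono; simp)
    hence "2 / (c * ln 2) * (c / 2 * ln (1 / \<epsilon>)) \<le> 2 / (c * ln 2) * (max C1 C2 * ?x + max C1 C2 * ?y)"
      using c by (intro mult_left_mono) auto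
    thus ?thesis
      using c by (simp add: log_def C_def algebra_simps)
  qed
  moreover have "0 < C" using c C by (simp add: C_def)
  ultimately show ?thesis by blast
qed

subsection \<open>Grover search in the plane of solutions and non-solutions\<close>

text \<open>
  A state of the search algorithm is described by one amplitude \<open>\<alpha>\<close> shared by all solutions and one
  amplitude \<open>\<beta>\<close> shared by all other items, dummies included; \<open>p\<close> is the proportion of solutions.
  A step multiplies the solutions by the phase \<open>y\<close> and then the uniform superposition by the phase \<open>z\<close>.
\<close>

definition plane_step :: "real \<Rightarrow> complex \<times> complex \<Rightarrow> complex \<times> complex \<Rightarrow> complex \<times> complex" where
  "plane_step p = (\<lambda>(y, z) (\<alpha>, \<beta>).
     (y * \<alpha> - (1 - z) * (of_real p * (y * \<alpha>) + of_real (1 - p) * \<beta>),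
      \<beta> - (1 - z) * (of_real p * (y * \<alpha>) + of_real (1 - p) * \<beta>)))"

definition plane_run :: "real \<Rightarrow> (complex \<times> complex) list \<Rightarrow> complex \<times> complex \<Rightarrow> complex \<times> complex" where
  "plane_run p = fold (plane_step p)"

text \<open>\<open>(0, 1)\<close> is, up to scaling, the state after a failed check. By linearity
  this is the factor by which a stage changes the amplitude of the non-solutions.\<close>

definition fail_amplitude :: "real \<Rightarrow> (complex \<times> complex) list \<Rightarrow> complex" where
  "fail_amplitude p zs = snd (plane_run p zs (0, 1))"

definition phases :: "(complex \<times> complex) set" where
  "phases = {(y, z). cmod y = 1 \<and> cmod z = 1}"

lemma plane_run_simps [simp]:
  "plane_run p [] v = v"
  "plane_run p (z # zs) v = plane_run p zs (plane_step p z v)"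
  "plane_run p (xs @ zs) v = plane_run p zs (plane_run p xs v)"
  by (simp_all add: plane_run_def)

lemma plane_run_scale:
  "plane_run p zs (c * \<alpha>, c * \<beta>) = (c * fst (plane_run p zs (\<alpha>, \<beta>)), c * snd (plane_run p zs (\<alpha>, \<beta>)))"
proof (induction zs arbitrary: \<alpha> \<beta>)
  case (Cons z zs)
  obtain y w where z: "z = (y, w)" by (cases z)
  have "plane_step p z (c * \<alpha>, c * \<beta>) = (c * fst (plane_step p z (\<alpha>, \<beta>)), c * snd (plane_step p z (\<alpha>, \<beta>)))"
    by (simp add: z plane_step_def algebra_simps)
  thus ?case
    using Cons.IH[of "fst (plane_step p z (\<alpha>, \<beta>))" "snd (plane_step p z (\<alpha>, \<beta>))"] by simp
qed simp

lemma snd_plane_run: "snd (plane_run p zs (0, \<beta>)) = \<beta> * fail_amplitude p zs"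
  using plane_run_scale[of p zs \<beta> 0 1] by (simp add: fail_amplitude_def)

text \<open>With these weights the form is the squared norm of the state, and both phase operations
  are unitary. In the expansion \<open>d\<close> the mixed term is linear in \<open>g\<close>;
  averaging turns \<open>g\<close> into \<open>\<mu>\<close>, and the mixed term then cancels
  \<open>2 * (1 - Re w) * (cmod \<mu>)\<^sup>2\<close>.\<close>

lemma plane_step_norm:
  assumes "z \<in> phases"
  shows "p * (cmod (fst (plane_step p z (\<alpha>, \<beta>))))\<^sup>2 + (1 - p) * (cmod (snd (plane_step p z (\<alpha>, \<beta>))))\<^sup>2
    = p * (cmod \<alpha>)\<^sup>2 + (1 - p) * (cmod \<beta>)\<^sup>2"
proof -
  obtain y w where z: "z = (y, w)" and y: "cmod y = 1" and w: "cmod w = 1"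
    using assms by (auto simp: phases_def)
  define \<alpha>' where "\<alpha>' = y * \<alpha>"
  have \<alpha>': "cmod \<alpha>' = cmod \<alpha>" by (simp add: \<alpha>'_def norm_mult y)
  define \<mu> where "\<mu> = of_real p * \<alpha>' + of_real (1 - p) * \<beta>"
  have w1: "(Re w)\<^sup>2 + (Im w)\<^sup>2 = 1" using w by (simp add: cmod_def)
  have \<mu>: "Re \<mu> = p * Re \<alpha>' + (1 - p) * Re \<beta>" "Im \<mu> = p * Im \<alpha>' + (1 - p) * Im \<beta>"
    by (simp_all add: \<mu>_def)
  have d: "(cmod (g - (1 - w) * \<mu>))\<^sup>2 = (cmod g)\<^sup>2 + 2 * (1 - Re w) * (cmod \<mu>)\<^sup>2
      - 2 * ((1 - Re w) * (Re g * Re \<mu> + Im g * Im \<mu>) + Im w * (Re g * Im \<mu> - Im g * Re \<mu>))" for g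
  proof -
    have "(cmod (g - (1 - w) * \<mu>))\<^sup>2 = (cmod g)\<^sup>2 + ((1 - Re w)\<^sup>2 + (Im w)\<^sup>2) * (cmod \<mu>)\<^sup>2
        - 2 * ((1 - Re w) * (Re g * Re \<mu> + Im g * Im \<mu>) + Im w * (Re g * Im \<mu> - Im g * Re \<mu>))"
      unfolding cmod_power2 by (simp add: power2_eq_square algebra_simps)
    moreover have "(1 - Re w)\<^sup>2 + (Im w)\<^sup>2 = 2 * (1 - Re w)"
      using w1 by (simp add: power2_diff)
    ultimately show ?thesis by simp
  qed
  have "p * (cmod (\<alpha>' - (1 - w) * \<mu>))\<^sup>2 + (1 - p) * (cmod (\<beta> - (1 - w) * \<mu>))\<^sup>2
      = p * (cmod \<alpha>')\<^sup>2 + (1 - p) * (cmod \<beta>)\<^sup>2 + 2 * (1 - Re w) * (cmod \<mu>)\<^sup>2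
        - 2 * ((1 - Re w) * (Re \<mu> * Re \<mu> + Im \<mu> * Im \<mu>) + Im w * (Re \<mu> * Im \<mu> - Im \<mu> * Re \<mu>))"
    unfolding d \<mu> by (simp add: algebra_simps)
  also have "\<dots> = p * (cmod \<alpha>')\<^sup>2 + (1 - p) * (cmod \<beta>)\<^sup>2"
    unfolding cmod_power2[of \<mu>] by (simp add: power2_eq_square)
  finally have "p * (cmod (\<alpha>' - (1 - w) * \<mu>))\<^sup>2 + (1 - p) * (cmod (\<beta> - (1 - w) * \<mu>))\<^sup>2
      = p * (cmod \<alpha>)\<^sup>2 + (1 - p) * (cmod \<beta>)\<^sup>2"
    unfolding \<alpha>' .
  moreover have "plane_step p z (\<alpha>, \<beta>) = (\<alpha>' - (1 - w) * \<mu>, \<beta> - (1 - w) * \<mu>)"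
    unfolding z plane_step_def \<mu>_def \<alpha>'_def by simp
  ultimately show ?thesis by simp
qed

lemma plane_run_norm:
  assumes "set zs \<subseteq> phases"
  shows "p * (cmod (fst (plane_run p zs v)))\<^sup>2 + (1 - p) * (cmod (snd (plane_run p zs v)))\<^sup>2
    = p * (cmod (fst v))\<^sup>2 + (1 - p) * (cmod (snd v))\<^sup>2"
  using assms
proof (induction zs arbitrary: v)
  case (Cons z zs)
  thus ?case using plane_step_norm[of z p "fst v" "snd v"] by simp
qed simp

text \<open>A stage tuned to a different number of solutions therefore does no harm.\<close>

lemma fail_amplitude_le_1:
  assumes "set zs \<subseteq> phases" "0 \<le> p" "p < 1"
  shows "cmod (fail_amplitude p zs) \<le> 1"
proof -
  let ?a = "p * (cmod (fst (plane_run p zs (0, 1))))\<^sup>2" and ?b = "(1 - p) * (cmod (fail_amplitude p zs))\<^sup>2"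
  have "?b \<le> ?a + ?b"
    using assms by (simp only: le_add_same_cancel2) simp
  also have "\<dots> = (1 - p) * 1"
    using plane_run_norm[OF assms(1), of p "(0, 1)"] by (simp add: fail_amplitude_def)
  finally have "(1 - p) * (cmod (fail_amplitude p zs))\<^sup>2 \<le> (1 - p) * 1" .
  hence "(cmod (fail_amplitude p zs))\<^sup>2 \<le> 1"
    using assms mult_le_cancel_left_pos[of "1 - p"] by simp
  thus ?thesis
    using abs_square_le_1[of "cmod (fail_amplitude p zs)"] by simp
qed

text \<open>Equal to \<open>2 * arcsin (sqrt p)\<close>, the usual rotation angle of a Grover
  iteration; in this form its cosine is affine in \<open>p\<close>.\<close>

definition grover_angle :: "real \<Rightarrow> real" where
  "grover_angle p = arccos (1 - 2 * p)"

lemma cos_grover_angle: "0 \<le> p \<Longrightarrow> p \<le> 1 \<Longrightarrow> cos (grover_angle p) = 1 - 2 * p"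
  by (simp add: grover_angle_def cos_arccos)

lemma grover_angle_bounds:
  assumes "0 < p" "p \<le> 1 / 2"
  shows "0 < grover_angle p" "grover_angle p \<le> pi / 2" "2 * sqrt p \<le> grover_angle p"
proof -
  let ?\<phi> = "grover_angle p"
  have "arccos 1 < arccos (1 - 2 * p)" using assms by (intro arccos_less_arccos) auto
  thus pos: "0 < ?\<phi>" by (simp add: grover_angle_def)
  show "?\<phi> \<le> pi / 2" unfolding grover_angle_def
    using arccos_le_arccos[of 0 "1 - 2 * p"] assms by simp
  have "1 - 2 * p = 1 - 2 * (sin (?\<phi> / 2))\<^sup>2"
    using cos_double_sin[of "?\<phi> / 2"] cos_grover_angle[of p] assms by simp
  hence p: "p = (sin (?\<phi> / 2))\<^sup>2" by simp
  have "sqrt p = \<bar>sin (?\<phi> / 2)\<bar>" using p by (metis real_sqrt_abs)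
  also have "\<dots> \<le> \<bar>?\<phi> / 2\<bar>" by (rule abs_sin_x_le_abs_x)
  finally show "2 * sqrt p \<le> ?\<phi>" using pos by simp
qed

lemma grover_angle_mono: "0 < p \<Longrightarrow> p \<le> q \<Longrightarrow> q \<le> 1 \<Longrightarrow> grover_angle p \<le> grover_angle q"
  unfolding grover_angle_def by (intro arccos_le_arccos) auto

text \<open>
  Grover iterations rotate the plane by the angle \<open>\<phi>\<close>.  The factor of the first component is the ratio
  \<open>sqrt ((1 - p) / p)\<close> of the norms of the two basis vectors, written without a root.
\<close>

lemma plane_run_grover:
  assumes p: "0 < p" "p \<le> 1 / 2" and \<phi>: "\<phi> = grover_angle p"
  shows "plane_run p (replicate m (-1, -1)) (0, 1) =
    (of_real ((-1) ^ m * (2 * (1 - p) / sin \<phi> * sin (real m * \<phi>))), of_real ((-1) ^ m * cos (real m * \<phi>)))"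
proof (induction m)
  case 0
  show ?case by simp
next
  case (Suc m)
  have c: "cos \<phi> = 1 - 2 * p" using p by (simp add: \<phi> cos_grover_angle)
  have s0: "sin \<phi> > 0"
    using grover_angle_bounds[OF p] by (intro sin_gt_zero) (auto simp: \<phi>)
  have s2: "sin \<phi> * sin \<phi> = 4 * p * (1 - p)"
    using sin_squared_eq[of \<phi>] by (simp add: c power2_eq_square algebra_simps)
  let ?g = "2 * (1 - p) / sin \<phi>"
  let ?a = "?g * sin (real m * \<phi>)" and ?b = "cos (real m * \<phi>)"
  have g: "2 * p * ?g = sin \<phi>"
    using s0 s2 by (simp add: field_simps)
  have a': "?g * sin (real (Suc m) * \<phi>) = ?a * (1 - 2 * p) + 2 * (1 - p) * ?b"
    using s0 by (simp add: distrib_right sin_add c field_simps)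
  have b': "cos (real (Suc m) * \<phi>) = (1 - 2 * p) * ?b - 2 * p * ?a"
  proof -
    have "2 * p * ?a = (2 * p * ?g) * sin (real m * \<phi>)" by (simp only: mult.assoc)
    hence "2 * p * ?a = sin \<phi> * sin (real m * \<phi>)" unfolding g .
    thus ?thesis by (simp add: distrib_right cos_add c)
  qed
  \<comment> \<open>Besides rotating, an iteration with both phases \<open>-1\<close> changes the
    global sign, which is kept apart as \<open>e\<close>.\<close>
  have step: "plane_step p (-1, -1) (of_real (e * A), of_real (e * B)) =
      (of_real (- e * (A * (1 - 2 * p) + 2 * (1 - p) * B)), of_real (- e * ((1 - 2 * p) * B - 2 * p * A)))"
    for e A B
    by (simp add: plane_step_def algebra_simps)
  have "replicate (Suc m) (-1, -1 :: complex) = replicate m (-1 :: complex, -1) @ [(-1, -1)]"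
    by (simp add: replicate_append_same)
  hence "plane_run p (replicate (Suc m) (-1, -1)) (0, 1) =
      plane_step p (-1, -1) (of_real ((-1) ^ m * ?a), of_real ((-1) ^ m * ?b))"
    by (simp only: plane_run_simps Suc)
  thus ?case
    unfolding step a' b' by (simp only: power_Suc mult_minus1)
qed

lemma fail_amplitude_grover:
  assumes "0 < p" "p \<le> 1 / 2"
  shows "cmod (fail_amplitude p (replicate m (-1, -1))) = \<bar>cos (real m * grover_angle p)\<bar>"
  using plane_run_grover[OF assms refl, of m]
  by (simp add: fail_amplitude_def norm_mult norm_power)

text \<open>
  Exact search: \<open>m\<close> iterations leave an angle \<open>\<delta> \<le> \<phi>\<close>, and one iteration with suitable phases removes
  the remaining amplitude.  Writing \<open>1 / (1 - z) = 1 / 2 + \<i> * s / 2\<close>, the real number \<open>s\<close> is chosen so that the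
  phase \<open>y\<close> has modulus one, which is possible because \<open>sin \<delta> * cos \<phi> \<le> sin \<phi> * cos \<delta>\<close>.
\<close>

lemma exact_search:
  assumes p: "0 < p" "p \<le> 1 / 2"
  shows "\<exists>zs. set zs \<subseteq> phases \<and> real (length zs) \<le> pi / (2 * grover_angle p) + 1 \<and> fail_amplitude p zs = 0"
proof -
  define \<phi> where "\<phi> = grover_angle p"
  have \<phi>: "0 < \<phi>" "\<phi> \<le> pi / 2" using grover_angle_bounds[OF p] by (auto simp: \<phi>_def)
  have c: "cos \<phi> = 1 - 2 * p" using p by (simp add: \<phi>_def cos_grover_angle)
  have s0: "sin \<phi> > 0" using \<phi> by (intro sin_gt_zero) auto
  have s2: "sin \<phi> * sin \<phi> = 4 * p * (1 - p)"
    using sin_squared_eq[of \<phi>] by (simp add: c power2_eq_square algebra_simps)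
  define m where "m = nat \<lfloor>pi / (2 * \<phi>)\<rfloor>"
  have ge: "1 \<le> pi / (2 * \<phi>)" using \<phi> by (simp add: field_simps)
  have m: "real m \<le> pi / (2 * \<phi>)" "pi / (2 * \<phi>) < real m + 1"
    using ge by (auto simp: m_def)
  have m1: "1 \<le> m" using ge by (simp add: m_def le_nat_iff)
  define \<delta> where "\<delta> = pi / 2 - real m * \<phi>"
  have \<delta>: "0 \<le> \<delta>" "\<delta> < \<phi>" using m \<phi> by (auto simp: \<delta>_def field_simps)
  have cm: "cos (real m * \<phi>) = sin \<delta>" and sm: "sin (real m * \<phi>) = cos \<delta>"
    by (simp_all add: \<delta>_def sin_diff cos_diff)
  have cd: "0 < cos \<delta>" using \<delta> \<phi> by (intro cos_gt_zero_pi) auto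
  have sd: "0 \<le> sin \<delta>" using \<delta> \<phi> by (intro sin_ge_zero) auto
  define e :: real where "e = (-1) ^ m"
  have run: "plane_run p (replicate m (-1, -1)) (0, 1) =
      (of_real (e * (2 * (1 - p) / sin \<phi> * cos \<delta>)), of_real (e * sin \<delta>))"
    using plane_run_grover[OF p \<phi>_def, of m] by (simp add: cm sm e_def)
  have phase1: "(-1, -1) \<in> phases" by (simp add: phases_def)
  have len: "real (Suc m) \<le> pi / (2 * grover_angle p) + 1" using m by (simp add: \<phi>_def)
  show ?thesis
  proof (cases "sin \<delta> = 0")
    case True
    have "fail_amplitude p (replicate m (-1, -1)) = 0"
      by (simp add: fail_amplitude_def run True)
    thus ?thesis using len phase1 by (intro exI[of _ "replicate m (-1, -1)"]) auto
  next
    case False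
    hence sd: "0 < sin \<delta>" using sd by simp
    have "0 \<le> sin (\<phi> - \<delta>)" using \<delta> \<phi> by (intro sin_ge_zero) auto
    hence "sin \<delta> * cos \<phi> \<le> sin \<phi> * cos \<delta>" by (simp add: sin_diff mult.commute)
    moreover have "0 \<le> cos \<phi>" using \<phi> by (intro cos_ge_zero) auto
    ultimately have "(sin \<delta> * cos \<phi>)\<^sup>2 \<le> (sin \<phi> * cos \<delta>)\<^sup>2"
      using sd by (intro power_mono) auto
    hence disc: "0 \<le> (sin \<phi> * cos \<delta> / sin \<delta>)\<^sup>2 - (cos \<phi>)\<^sup>2"
      using sd by (simp add: power_divide power_mult_distrib field_simps)
    define s where "s = sqrt ((sin \<phi> * cos \<delta> / sin \<delta>)\<^sup>2 - (cos \<phi>)\<^sup>2)"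
    have ss: "s\<^sup>2 = (sin \<phi> * cos \<delta> / sin \<delta>)\<^sup>2 - (cos \<phi>)\<^sup>2" using disc by (simp add: s_def)
    \<comment> \<open>The non-solution amplitude vanishes iff
      \<open>p * y * A + (1 - p) * sin \<delta> = sin \<delta> / (1 - z)\<close>, with
      \<open>A\<close> the solution amplitude below. Inserting
      \<open>1 - p = (1 + cos \<phi>) / 2\<close> and
      \<open>p * A = sin \<phi> * cos \<delta> / 2\<close> and solving for \<open>y\<close> gives
      this formula.\<close>
    define y where "y = Complex (- cos \<phi>) s * of_real (sin \<delta> / (sin \<phi> * cos \<delta>))"
    define z where "z = Complex (-1) s / Complex 1 s"
    have n0: "Complex 1 s \<noteq> 0" by (simp add: complex_eq_iff)
    have y1: "cmod y = 1"
    proof -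
      have "cmod (Complex (- cos \<phi>) s) = sin \<phi> * cos \<delta> / sin \<delta>"
        using sd s0 cd ss by (simp add: cmod_def)
      thus ?thesis using sd s0 cd by (simp add: y_def norm_mult norm_divide)
    qed
    have "cmod (Complex (-1) s) = cmod (Complex 1 s)" by (simp add: cmod_def)
    hence z1: "cmod z = 1" using n0 by (simp add: z_def norm_divide)
    have z: "1 - z = 2 / Complex 1 s"
    proof -
      have "Complex 1 s - Complex (-1) s = 2" by (simp add: complex_eq_iff)
      moreover have "1 - z = (Complex 1 s - Complex (-1) s) / Complex 1 s"
        using n0 by (simp add: z_def diff_divide_distrib)
      ultimately show ?thesis by simp
    qed
    have y: "y * of_real (sin \<phi> * cos \<delta>) = Complex (- cos \<phi>) s * of_real (sin \<delta>)"
      using s0 cd by (simp add: y_def)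
    define A where "A = 2 * (1 - p) / sin \<phi> * cos \<delta>"
    have A: "p * A = sin \<phi> * cos \<delta> / 2"
    proof -
      have "p * A = 4 * p * (1 - p) * cos \<delta> / (2 * sin \<phi>)" by (simp add: A_def)
      thus ?thesis using s0 by (simp add: s2[symmetric])
    qed
    have "of_real p * (y * of_real A) = y * of_real (p * A)" by simp
    also have "\<dots> = Complex (- cos \<phi>) s * of_real (sin \<delta>) / 2"
      unfolding A using y by simp
    finally have sum_eq: "of_real p * (y * of_real A) + of_real (1 - p) * of_real (sin \<delta>)
        = Complex 1 s * of_real (sin \<delta>) / 2"
      by (simp add: c complex_eq_iff field_simps)
    have "snd (plane_step p (y, z) (of_real A, of_real (sin \<delta>))) =
        of_real (sin \<delta>) - (1 - z) * (of_real p * (y * of_real A) + of_real (1 - p) * of_real (sin \<delta>))"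
      by (simp only: plane_step_def prod.case snd_conv)
    also have "\<dots> = 0"
      unfolding z sum_eq using n0 by simp
    finally have "snd (plane_step p (y, z) (of_real A, of_real (sin \<delta>))) = 0" .
    moreover have "plane_step p (y, z) (of_real (e * A), of_real (e * sin \<delta>)) =
        (of_real e * fst (plane_step p (y, z) (of_real A, of_real (sin \<delta>))),
         of_real e * snd (plane_step p (y, z) (of_real A, of_real (sin \<delta>))))"
      using plane_run_scale[of p "[(y, z)]" "of_real e" "of_real A" "of_real (sin \<delta>)"] by simp
    ultimately have "fail_amplitude p (replicate m (-1, -1) @ [(y, z)]) = 0"
      by (simp add: fail_amplitude_def run A_def del: of_real_mult of_real_divide)
    thus ?thesis using len phase1 y1 z1
      by (intro exI[of _ "replicate m (-1, -1) @ [(y, z)]"]) (auto simp: phases_def)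
  qed
qed

subsection \<open>The search circuit\<close>

definition gate_matrix :: "nat \<Rightarrow> nat \<Rightarrow> (nat \<times> bool \<times> nat \<Rightarrow> nat \<times> bool \<times> nat \<Rightarrow> complex) \<Rightarrow> complex mat" where
  "gate_matrix N W K = mat (2 * N * W) (2 * N * W) (\<lambda>(r, c). K (registers N r) (registers N c))"

lemma gate_matrix_carrier [simp]: "gate_matrix N W K \<in> carrier_mat (2 * N * W) (2 * N * W)"
  by (simp add: gate_matrix_def)

lemma gate_matrix_amplitude:
  assumes r: "r \<in> register_set N W" and v: "v \<in> carrier_vec (2 * N * W)"
  shows "(gate_matrix N W K *\<^sub>v v) $ basis_index N r = (\<Sum>c\<in>register_set N W. K r c * v $ basis_index N c)"
proof -
  have N: "0 < N" using r by (auto simp: register_set_def split: if_splits)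
  have "(gate_matrix N W K *\<^sub>v v) $ basis_index N r = (\<Sum>i<2 * N * W. K r (registers N i) * v $ i)"
    using v basis_index_less[OF r] registers_basis_index[OF r]
    by (auto simp: gate_matrix_def scalar_prod_def atLeast0LessThan intro!: sum.cong)
  also have "\<dots> = (\<Sum>c\<in>register_set N W. K r c * v $ basis_index N c)"
    unfolding sum_basis_index[OF N] by (intro sum.cong refl) (simp add: registers_basis_index)
  finally show ?thesis .
qed

lemma unitary_gate_matrix:
  assumes "0 < N"
    and "\<And>r s. r \<in> register_set N W \<Longrightarrow> s \<in> register_set N W \<Longrightarrow>
      (\<Sum>c\<in>register_set N W. K r c * cnj (K s c)) = of_bool (r = s)"
  shows "unitary (2 * N * W) (gate_matrix N W K)"
  unfolding gate_matrix_def
proof (rule unitaryI)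
  fix r s assume r: "r < 2 * N * W" and s: "s < 2 * N * W"
  have "(\<Sum>c<2 * N * W. K (registers N r) (registers N c) * cnj (K (registers N s) (registers N c))) =
      (\<Sum>c\<in>register_set N W. K (registers N r) c * cnj (K (registers N s) c))"
    unfolding sum_basis_index[OF assms(1)] by (intro sum.cong refl) (simp add: registers_basis_index)
  also have "\<dots> = of_bool (registers N r = registers N s)"
    using assms(2) r s by (simp add: registers_in_register_set)
  also have "registers N r = registers N s \<longleftrightarrow> r = s"
    using basis_index_registers[OF assms(1)] by metis
  finally show "(\<Sum>c<2 * N * W. K (registers N r) (registers N c) * cnj (K (registers N s) (registers N c))) =
      of_bool (r = s)" .
qed

text \<open>
  In the workspace register \<open>w = d + 2 * f\<close>, the bit \<open>d\<close> tells real items from dummies, and \<open>f\<close> is \<open>0\<close> as long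
  as no solution has been found, and otherwise the number of the check that found one.  Each check uses a fresh
  value of \<open>f\<close>, so that swapping it with \<open>0\<close> never brings back a state that was already flagged.
\<close>

definition active :: "nat \<times> bool \<times> nat \<Rightarrow> bool" where
  "active = (\<lambda>(j, b, w). b \<and> w = 0)"

text \<open>Placed between two queries, on states with cleared target bit, it applies the phase to
  exactly the unflagged real solutions.\<close>

definition phase_gate :: "nat \<Rightarrow> nat \<Rightarrow> complex \<Rightarrow> complex mat" where
  "phase_gate N W z = gate_matrix N W (\<lambda>r c. of_bool (c = r) * (if active r then z else 1))"

text \<open>The uniform superposition of the \<open>N\<close> real items (\<open>w = 0\<close>) and
  the \<open>N\<close> dummies (\<open>w = 1\<close>), unflagged and with cleared target
  bit.\<close>

definition item_amplitude :: "nat \<Rightarrow> nat \<times> bool \<times> nat \<Rightarrow> real" where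
  "item_amplitude N = (\<lambda>(j, b, w). if \<not> b \<and> w < 2 then 1 / sqrt (2 * real N) else 0)"

definition diffusion_gate :: "nat \<Rightarrow> nat \<Rightarrow> complex \<Rightarrow> complex mat" where
  "diffusion_gate N W z = gate_matrix N W
     (\<lambda>r c. of_bool (c = r) - (1 - z) * of_real (item_amplitude N r) * of_real (item_amplitude N c))"

definition swap_flag :: "nat \<Rightarrow> nat \<times> bool \<times> nat \<Rightarrow> nat \<times> bool \<times> nat" where
  "swap_flag f = (\<lambda>(j, b, w). (j, b, if b \<and> w = 0 then 2 * f else if b \<and> w = 2 * f then 0 else w))"

definition flag_gate :: "nat \<Rightarrow> nat \<Rightarrow> nat \<Rightarrow> complex mat" where
  "flag_gate N W f = gate_matrix N W (\<lambda>r c. of_bool (c = swap_flag f r))"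

lemma swap_flag_swap_flag [simp]: "swap_flag f (swap_flag f r) = r"
  by (auto simp: swap_flag_def split: prod.splits)

lemma swap_flag_in_register_set:
  "2 * f < W \<Longrightarrow> r \<in> register_set N W \<Longrightarrow> swap_flag f r \<in> register_set N W"
  by (auto simp: swap_flag_def register_set_def split: prod.splits)

lemma sum_items:
  fixes h :: "nat \<times> bool \<times> nat \<Rightarrow> 'a :: comm_monoid_add"
  assumes W: "2 \<le> W"
    and h: "\<And>j b w. (j, b, w) \<in> register_set N W \<Longrightarrow> h (j, b, w) = (if \<not> b \<and> w < 2 then g j w else 0)"
  shows "(\<Sum>r\<in>register_set N W. h r) = (\<Sum>j<N. g j 0 + g j 1)"
proof -
  have "(\<Sum>r\<in>register_set N W. h r) = (\<Sum>r\<in>{..<N} \<times> {False} \<times> {0, 1}. h r)"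
    using W h by (intro sum.mono_neutral_right) (auto simp: register_set_def split: if_splits)
  also have "\<dots> = (\<Sum>j<N. \<Sum>b\<in>{False}. \<Sum>w\<in>{0, 1}. h (j, b, w))"
    by (simp only: sum.cartesian_product split_def prod.collapse)
  also have "\<dots> = (\<Sum>j<N. g j 0 + g j 1)"
    using W by (intro sum.cong refl) (simp add: h register_set_def)
  finally show ?thesis .
qed

lemma sum_item_amplitude_sq:
  assumes "0 < N" "2 \<le> W"
  shows "(\<Sum>r\<in>register_set N W. (item_amplitude N r)\<^sup>2) = 1"
proof -
  have "(\<Sum>r\<in>register_set N W. (item_amplitude N r)\<^sup>2) = (\<Sum>j<N. 1 / (2 * real N) + 1 / (2 * real N))"
    by (rule sum_items[OF assms(2)]) (simp add: item_amplitude_def power_divide)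
  thus ?thesis using assms by simp
qed

lemma unitary_phase_gate:
  assumes "0 < N" "cmod z = 1"
  shows "unitary (2 * N * W) (phase_gate N W z)"
  unfolding phase_gate_def
proof (rule unitary_gate_matrix[OF assms(1)])
  fix r s assume r: "r \<in> register_set N W" "s \<in> register_set N W"
  let ?e = "\<lambda>r. if active r then z else 1"
  have z: "z * cnj z = 1" using assms(2) complex_norm_square[of z] by simp
  have "(\<Sum>c\<in>register_set N W. of_bool (c = r) * ?e r * cnj (of_bool (c = s) * ?e s)) =
      (\<Sum>c\<in>register_set N W. of_bool (c = r) * (?e r * cnj (of_bool (c = s) * ?e s)))"
    by (simp only: mult.assoc)
  also have "\<dots> = ?e r * cnj (of_bool (r = s) * ?e s)"
    using r by (intro sum_of_bool_eq_mult) auto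
  also have "\<dots> = of_bool (r = s)"
    using z by auto
  finally show "(\<Sum>c\<in>register_set N W. of_bool (c = r) * ?e r * cnj (of_bool (c = s) * ?e s)) = of_bool (r = s)" .
qed

lemma unitary_flag_gate:
  assumes "0 < N" "2 * f < W"
  shows "unitary (2 * N * W) (flag_gate N W f)"
  unfolding flag_gate_def
proof (rule unitary_gate_matrix[OF assms(1)])
  fix r s assume r: "r \<in> register_set N W" "s \<in> register_set N W"
  have "(\<Sum>c\<in>register_set N W. of_bool (c = swap_flag f r) * cnj (of_bool (c = swap_flag f s))) =
      (cnj (of_bool (swap_flag f r = swap_flag f s)) :: complex)"
    using r swap_flag_in_register_set[OF assms(2)] by (intro sum_of_bool_eq_mult) auto
  also have "swap_flag f r = swap_flag f s \<longleftrightarrow> r = s"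
    using swap_flag_swap_flag by metis
  also have "cnj (of_bool (r = s)) = of_bool (r = s)" by simp
  finally show "(\<Sum>c\<in>register_set N W. of_bool (c = swap_flag f r) * cnj (of_bool (c = swap_flag f s))) =
      (of_bool (r = s) :: complex)" .
qed

text \<open>The gate is the identity minus \<open>1 - z\<close> times the projection onto a unit
  vector. The rank-one terms cancel because
  \<open>(1 - z) * (1 - cnj z) = (1 - z) + (1 - cnj z)\<close> for \<open>z\<close> on the unit
  circle.\<close>

lemma unitary_diffusion_gate:
  assumes "0 < N" "2 \<le> W" "cmod z = 1"
  shows "unitary (2 * N * W) (diffusion_gate N W z)"
  unfolding diffusion_gate_def
proof (rule unitary_gate_matrix[OF assms(1)])
  fix r s assume r: "r \<in> register_set N W" "s \<in> register_set N W"
  let ?R = "register_set N W"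
  let ?u = "\<lambda>r. complex_of_real (item_amplitude N r)"
  have norm: "(\<Sum>c\<in>?R. ?u c * ?u c) = 1"
    using sum_item_amplitude_sq[OF assms(1,2)]
    by (simp add: power2_eq_square flip: of_real_mult of_real_sum)
  have z: "(1 - z) * (1 - cnj z) = (1 - z) + (1 - cnj z)"
    using assms(3) complex_norm_square[of z] by (simp add: algebra_simps)
  have "(\<Sum>c\<in>?R. (of_bool (c = r) - (1 - z) * ?u r * ?u c) * cnj (of_bool (c = s) - (1 - z) * ?u s * ?u c)) =
      (\<Sum>c\<in>?R. of_bool (c = r) * (of_bool (c = s) - (1 - cnj z) * ?u s * ?u c))
      - (\<Sum>c\<in>?R. of_bool (c = s) * ((1 - z) * ?u r * ?u c))
      + (1 - z) * (1 - cnj z) * ?u r * ?u s * (\<Sum>c\<in>?R. ?u c * ?u c)"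
  proof -
    have "(of_bool (c = r) - (1 - z) * ?u r * ?u c) * cnj (of_bool (c = s) - (1 - z) * ?u s * ?u c) =
        of_bool (c = r) * (of_bool (c = s) - (1 - cnj z) * ?u s * ?u c) - of_bool (c = s) * ((1 - z) * ?u r * ?u c)
        + (1 - z) * (1 - cnj z) * ?u r * ?u s * (?u c * ?u c)" for c
    proof -
      have "cnj (of_bool (c = s)) = of_bool (c = s)" by simp
      thus ?thesis by (simp add: algebra_simps)
    qed
    thus ?thesis
      by (simp only: sum.distrib sum_subtractf sum_distrib_left)
  qed
  also have "(\<Sum>c\<in>?R. of_bool (c = r) * (of_bool (c = s) - (1 - cnj z) * ?u s * ?u c)) =
      of_bool (r = s) - (1 - cnj z) * ?u s * ?u r"
    using r by (intro sum_of_bool_eq_mult) auto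
  also have "(\<Sum>c\<in>?R. of_bool (c = s) * ((1 - z) * ?u r * ?u c)) = (1 - z) * ?u r * ?u s"
    using r by (intro sum_of_bool_eq_mult) auto
  finally show "(\<Sum>c\<in>?R. (of_bool (c = r) - (1 - z) * ?u r * ?u c) * cnj (of_bool (c = s) - (1 - z) * ?u s * ?u c))
      = of_bool (r = s)"
    unfolding norm z by (simp add: algebra_simps)
qed

lemma phase_gate_amplitude:
  assumes "r \<in> register_set N W" "v \<in> carrier_vec (2 * N * W)"
  shows "(phase_gate N W z *\<^sub>v v) $ basis_index N r = (if active r then z else 1) * v $ basis_index N r"
  unfolding phase_gate_def gate_matrix_amplitude[OF assms] mult.assoc
  using assms by (intro sum_of_bool_eq_mult) auto

lemma flag_gate_amplitude:
  assumes "r \<in> register_set N W" "v \<in> carrier_vec (2 * N * W)" "2 * f < W"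
  shows "(flag_gate N W f *\<^sub>v v) $ basis_index N r = v $ basis_index N (swap_flag f r)"
  unfolding flag_gate_def gate_matrix_amplitude[OF assms(1,2)]
  using assms swap_flag_in_register_set by (intro sum_of_bool_eq_mult) auto

lemma diffusion_gate_amplitude:
  assumes "r \<in> register_set N W" "v \<in> carrier_vec (2 * N * W)"
  shows "(diffusion_gate N W z *\<^sub>v v) $ basis_index N r = v $ basis_index N r -
    (1 - z) * of_real (item_amplitude N r) *
      (\<Sum>c\<in>register_set N W. of_real (item_amplitude N c) * v $ basis_index N c)"
proof -
  have "(\<Sum>c\<in>register_set N W. of_bool (c = r) * v $ basis_index N c) = v $ basis_index N r"
    using assms by (intro sum_of_bool_eq_mult) auto
  thus ?thesis
    unfolding diffusion_gate_def gate_matrix_amplitude[OF assms]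
    by (simp add: left_diff_distrib sum_subtractf sum_distrib_left mult.assoc)
qed

section \<open>Gate sequences and the invariant of the circuit\<close>

definition run_gates :: "nat \<Rightarrow> nat \<Rightarrow> (nat \<Rightarrow> bool) \<Rightarrow> complex mat list \<Rightarrow> complex vec \<Rightarrow> complex vec" where
  "run_gates N W x = fold (\<lambda>g v. g *\<^sub>v (query_gate N W x *\<^sub>v v))"

lemma run_gates_simps [simp]:
  "run_gates N W x [] v = v"
  "run_gates N W x (g # gs) v = run_gates N W x gs (g *\<^sub>v (query_gate N W x *\<^sub>v v))"
  "run_gates N W x (gs @ hs) v = run_gates N W x hs (run_gates N W x gs v)"
  by (simp_all add: run_gates_def)

text \<open>\<open>run_gates\<close> puts a query before every gate, so an iteration and a check
  cost two queries each. The second query erases the target bit; after a check nothing else remains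
  to be done, hence the identity in \<open>check_gates\<close>.\<close>

definition iteration_gates :: "nat \<Rightarrow> nat \<Rightarrow> complex \<times> complex \<Rightarrow> complex mat list" where
  "iteration_gates N W = (\<lambda>(y, z). [phase_gate N W y, diffusion_gate N W z])"

definition check_gates :: "nat \<Rightarrow> nat \<Rightarrow> nat \<Rightarrow> complex mat list" where
  "check_gates N W f = [flag_gate N W f, 1\<^sub>m (2 * N * W)]"

definition layered_amplitude :: "(nat \<Rightarrow> bool) \<Rightarrow> complex \<Rightarrow> complex \<Rightarrow> nat \<times> bool \<times> nat \<Rightarrow> complex" where
  "layered_amplitude x \<alpha> \<beta> = (\<lambda>(j, b, w). if b then 0 else if x j \<and> w = 0 then \<alpha> else \<beta>)"

text \<open>Amplitudes of solutions under flags below \<open>f\<close> are left open: they belong to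
  successful branches, which contribute no error. Flags from \<open>f\<close> on are still empty. A
  dummy carries \<open>\<beta>\<close> even if its index is a solution.\<close>

definition layered :: "nat \<Rightarrow> nat \<Rightarrow> (nat \<Rightarrow> bool) \<Rightarrow> nat \<Rightarrow> complex \<times> complex \<Rightarrow> complex vec \<Rightarrow> bool" where
  "layered N W x f = (\<lambda>(\<alpha>, \<beta>) v. v \<in> carrier_vec (2 * N * W) \<and>
     (\<forall>j b w. (j, b, w) \<in> register_set N W \<longrightarrow>
        (w < 2 \<longrightarrow> v $ basis_index N (j, b, w) = layered_amplitude x \<alpha> \<beta> (j, b, w)) \<and>
        (2 \<le> w \<and> (\<not> x j \<or> 2 * f \<le> w) \<longrightarrow> v $ basis_index N (j, b, w) = 0)))"

lemma layeredI:
  assumes "v \<in> carrier_vec (2 * N * W)"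
    and "\<And>j b w. (j, b, w) \<in> register_set N W \<Longrightarrow> w < 2 \<Longrightarrow>
      v $ basis_index N (j, b, w) = layered_amplitude x \<alpha> \<beta> (j, b, w)"
    and "\<And>j b w. (j, b, w) \<in> register_set N W \<Longrightarrow> 2 \<le> w \<Longrightarrow> \<not> x j \<or> 2 * f \<le> w \<Longrightarrow>
      v $ basis_index N (j, b, w) = 0"
  shows "layered N W x f (\<alpha>, \<beta>) v"
  unfolding layered_def prod.case using assms by blast

lemma layeredD:
  assumes "layered N W x f (\<alpha>, \<beta>) v"
  shows "v \<in> carrier_vec (2 * N * W)"
    and "\<And>j b w. (j, b, w) \<in> register_set N W \<Longrightarrow> w < 2 \<Longrightarrow>
      v $ basis_index N (j, b, w) = layered_amplitude x \<alpha> \<beta> (j, b, w)"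
    and "\<And>j b w. (j, b, w) \<in> register_set N W \<Longrightarrow> 2 \<le> w \<Longrightarrow> \<not> x j \<or> 2 * f \<le> w \<Longrightarrow>
      v $ basis_index N (j, b, w) = 0"
  using assms unfolding layered_def prod.case by blast+

lemma layered_iteration:
  assumes N: "0 < N" and W: "2 \<le> W" and f: "1 \<le> f" and v: "layered N W x f a v"
  shows "layered N W x f (plane_step (real (card (solutions N x)) / (2 * real N)) z a)
    (run_gates N W x (iteration_gates N W z) v)"
proof -
  obtain \<alpha> \<beta> where a: "a = (\<alpha>, \<beta>)" by (cases a)
  obtain y z' where z: "z = (y, z')" by (cases z)
  let ?k = "card (solutions N x)"
  define p where "p = real ?k / (2 * real N)"
  define Q where "Q = query_gate N W x"
  have Q: "Q *\<^sub>v u \<in> carrier_vec (2 * N * W)" if "u \<in> carrier_vec (2 * N * W)" for u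
    using that by (auto simp: Q_def intro!: mult_mat_vec_carrier query_gate_carrier)
  have Qa: "(Q *\<^sub>v u) $ basis_index N r = u $ basis_index N (flip_target x r)"
    if "r \<in> register_set N W" "u \<in> carrier_vec (2 * N * W)" for r u
    unfolding Q_def using that by (rule query_gate_amplitude)
  have P: "phase_gate N W y *\<^sub>v u \<in> carrier_vec (2 * N * W)" if "u \<in> carrier_vec (2 * N * W)" for u
    using that by (auto simp: phase_gate_def intro!: mult_mat_vec_carrier)
  note vc = layeredD(1)[OF v[unfolded a]] and v1 = layeredD(2)[OF v[unfolded a]]
    and v2 = layeredD(3)[OF v[unfolded a]]
  define u where "u = Q *\<^sub>v (phase_gate N W y *\<^sub>v (Q *\<^sub>v v))"
  have uc: "u \<in> carrier_vec (2 * N * W)" using vc by (simp add: u_def P Q)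
  have u: "u $ basis_index N r = (if active (flip_target x r) then y else 1) * v $ basis_index N r"
    if r: "r \<in> register_set N W" for r
    unfolding u_def using r vc P Q
    by (simp add: Qa phase_gate_amplitude del: index_mult_mat_vec)
  have u1: "u $ basis_index N (j, b, w) = layered_amplitude x (y * \<alpha>) \<beta> (j, b, w)"
    if "(j, b, w) \<in> register_set N W" "w < 2" for j b w
    using that by (auto simp: u v1 layered_amplitude_def active_def flip_target_def)
  have u2: "u $ basis_index N (j, b, w) = 0"
    if "(j, b, w) \<in> register_set N W" "2 \<le> w" "\<not> x j \<or> 2 * f \<le> w" for j b w
    using that by (simp add: u v2)
  define \<mu> where "\<mu> = of_real p * (y * \<alpha>) + of_real (1 - p) * \<beta>"
  define S where "S = (\<Sum>c\<in>register_set N W. of_real (item_amplitude N c) * u $ basis_index N c)"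
  have S: "S = of_real (sqrt (2 * real N)) * \<mu>"
  proof -
    have "S = (\<Sum>j<N. of_real (1 / sqrt (2 * real N)) * (if x j then y * \<alpha> else \<beta>) +
        of_real (1 / sqrt (2 * real N)) * \<beta>)"
      unfolding S_def
      by (subst sum_items[OF W, where
            g = "\<lambda>j w. of_real (1 / sqrt (2 * real N)) * (if x j \<and> w = 0 then y * \<alpha> else \<beta>)"])
         (auto simp: item_amplitude_def u1 layered_amplitude_def)
    also have "\<dots> = of_real (1 / sqrt (2 * real N)) * ((\<Sum>j<N. if x j then y * \<alpha> else \<beta>) + of_nat N * \<beta>)"
      by (simp only: sum_distrib_left[symmetric] sum.distrib sum_constant card_lessThan distrib_left mult.left_commute)
    also have "(\<Sum>j<N. if x j then y * \<alpha> else \<beta>) = of_nat ?k * (y * \<alpha>) + of_nat (N - ?k) * \<beta>"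
    proof -
      have "{..<N} \<inter> {j. x j} = solutions N x" "{..<N} \<inter> - {j. x j} = {..<N} - solutions N x"
        by (auto simp: solutions_def)
      moreover have "card ({..<N} - solutions N x) = N - ?k"
        by (subst card_Diff_subset) (auto simp: solutions_def)
      ultimately show ?thesis by (simp add: sum.If_cases)
    qed
    \<comment> \<open>Of the \<open>2 * N\<close> items, \<open>2 * N * p\<close> are real
      solutions; the other \<open>2 * N * (1 - p)\<close> include all dummies.\<close>
    also have "of_nat ?k * (y * \<alpha>) + of_nat (N - ?k) * \<beta> + of_nat N * \<beta> = of_real (2 * real N) * \<mu>"
    proof -
      have "?k \<le> N" using card_mono[of "{..<N}" "solutions N x"] by (auto simp: solutions_def)
      moreover have "(2 * of_nat N * of_real p :: complex) = of_nat ?k"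
        using N by (simp add: p_def)
      ultimately show ?thesis by (simp add: \<mu>_def algebra_simps)
    qed
    also have "of_real (1 / sqrt (2 * real N)) * (of_real (2 * real N) * \<mu>) = of_real (1 / sqrt (2 * real N) * (2 * real N)) * \<mu>"
      by (simp only: of_real_mult mult.assoc)
    also have "1 / sqrt (2 * real N) * (2 * real N) = sqrt (2 * real N)"
      by (simp add: real_div_sqrt)
    finally show ?thesis .
  qed
  define t where "t = diffusion_gate N W z' *\<^sub>v u"
  have tc: "t \<in> carrier_vec (2 * N * W)"
    using uc by (auto simp: t_def diffusion_gate_def intro!: mult_mat_vec_carrier)
  have t: "t $ basis_index N (j, b, w) = u $ basis_index N (j, b, w) - (if \<not> b \<and> w < 2 then (1 - z') * \<mu> else 0)"
    if r: "(j, b, w) \<in> register_set N W" for j b w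
    unfolding t_def diffusion_gate_amplitude[OF r uc] S_def[symmetric] S
    using N by (simp add: item_amplitude_def)
  have "plane_step p z a = (y * \<alpha> - (1 - z') * \<mu>, \<beta> - (1 - z') * \<mu>)"
    by (simp add: a z plane_step_def \<mu>_def)
  moreover have "layered N W x f (y * \<alpha> - (1 - z') * \<mu>, \<beta> - (1 - z') * \<mu>) t"
    by (rule layeredI[OF tc]) (auto simp: t u1 u2 layered_amplitude_def)
  moreover have "run_gates N W x (iteration_gates N W z) v = t"
    by (simp add: iteration_gates_def z t_def u_def Q_def)
  ultimately show ?thesis
    unfolding p_def[symmetric] by (simp only:)
qed

text \<open>The first query raises the target bit of the solutions, the swap moves those with
  \<open>w = 0\<close> to flag \<open>f\<close>, and the second query lowers the bit again. Flag
  \<open>f\<close> was empty before, so what the swap brings back to \<open>w = 0\<close> is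
  zero.\<close>

lemma layered_check:
  assumes f: "1 \<le> f" "2 * f < W" and v: "layered N W x f (\<alpha>, \<beta>) v"
  shows "layered N W x (Suc f) (0, \<beta>) (run_gates N W x (check_gates N W f) v)"
proof -
  define Q where "Q = query_gate N W x"
  have Q: "Q *\<^sub>v u \<in> carrier_vec (2 * N * W)" if "u \<in> carrier_vec (2 * N * W)" for u
    using that by (auto simp: Q_def intro!: mult_mat_vec_carrier query_gate_carrier)
  have Qa: "(Q *\<^sub>v u) $ basis_index N r = u $ basis_index N (flip_target x r)"
    if "r \<in> register_set N W" "u \<in> carrier_vec (2 * N * W)" for r u
    unfolding Q_def using that by (rule query_gate_amplitude)
  have F: "flag_gate N W f *\<^sub>v u \<in> carrier_vec (2 * N * W)" if "u \<in> carrier_vec (2 * N * W)" for u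
    using that by (auto simp: flag_gate_def intro!: mult_mat_vec_carrier)
  note vc = layeredD(1)[OF v] and v1 = layeredD(2)[OF v] and v2 = layeredD(3)[OF v]
  define t where "t = Q *\<^sub>v (flag_gate N W f *\<^sub>v (Q *\<^sub>v v))"
  have tc: "t \<in> carrier_vec (2 * N * W)" using vc by (simp add: t_def F Q)
  have t: "t $ basis_index N r = v $ basis_index N (flip_target x (swap_flag f (flip_target x r)))"
    if r: "r \<in> register_set N W" for r
    unfolding t_def using r vc F Q f
    by (simp add: Qa flag_gate_amplitude swap_flag_in_register_set
        del: index_mult_mat_vec)
  have "layered N W x (Suc f) (0, \<beta>) t"
  proof (rule layeredI[OF tc])
    fix j b w assume "(j, b, w) \<in> register_set N W" "w < 2"
    thus "t $ basis_index N (j, b, w) = layered_amplitude x 0 \<beta> (j, b, w)"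
      using f by (cases "x j"; cases b; cases "w = 0")
        (auto simp: t flip_target_def swap_flag_def register_set_def v1 v2 layered_amplitude_def)
  next
    fix j b w assume "(j, b, w) \<in> register_set N W" "2 \<le> w" "\<not> x j \<or> 2 * Suc f \<le> w"
    thus "t $ basis_index N (j, b, w) = 0"
      using f by (cases "x j"; cases b; cases "w = 2 * f")
        (auto simp: t flip_target_def swap_flag_def register_set_def v1 v2 layered_amplitude_def)
  qed
  moreover have "run_gates N W x (check_gates N W f) v = t"
    using tc by (simp add: check_gates_def t_def Q_def)
  ultimately show ?thesis
    by (simp only:)
qed

lemma layered_iterations:
  assumes "0 < N" "2 \<le> W" "1 \<le> f" "layered N W x f a v"
  shows "layered N W x f (plane_run (real (card (solutions N x)) / (2 * real N)) zs a)
    (run_gates N W x (concat (map (iteration_gates N W) zs)) v)"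
  using assms(4)
proof (induction zs arbitrary: a v)
  case (Cons z zs)
  thus ?case using layered_iteration[OF assms(1-3)] by simp
qed simp

primrec stage_gates :: "nat \<Rightarrow> nat \<Rightarrow> nat \<Rightarrow> (complex \<times> complex) list list \<Rightarrow> complex mat list" where
  "stage_gates N W f [] = []"
| "stage_gates N W f (zs # zss) =
     concat (map (iteration_gates N W) zs) @ check_gates N W f @ stage_gates N W (Suc f) zss"

lemma layered_stages:
  assumes "0 < N" "1 \<le> f" "2 * (f + length zss) \<le> W" "layered N W x f (0, \<beta>) v" "2 \<le> W"
  shows "layered N W x (f + length zss)
    (0, \<beta> * (\<Prod>zs\<leftarrow>zss. fail_amplitude (real (card (solutions N x)) / (2 * real N)) zs))
    (run_gates N W x (stage_gates N W f zss) v)"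
  using assms(2-4)
proof (induction zss arbitrary: f \<beta> v)
  case (Cons zs zss)
  let ?p = "real (card (solutions N x)) / (2 * real N)"
  let ?v = "run_gates N W x (concat (map (iteration_gates N W) zs)) v"
  have "layered N W x f (plane_run ?p zs (0, \<beta>)) ?v"
    by (rule layered_iterations) (use Cons.prems assms in auto)
  hence "layered N W x f (fst (plane_run ?p zs (0, \<beta>)), \<beta> * fail_amplitude ?p zs) ?v"
    by (metis prod.collapse snd_plane_run)
  hence "layered N W x (Suc f) (0, \<beta> * fail_amplitude ?p zs) (run_gates N W x (check_gates N W f) ?v)"
    by (intro layered_check) (use Cons.prems in auto)
  from Cons.IH[OF _ _ this] Cons.prems show ?case by (simp add: mult.assoc)
qed simp

lemma unitary_stage_gates:
  assumes "0 < N" "2 \<le> W" "1 \<le> f" "2 * (f + length zss) \<le> W" "\<forall>zs\<in>set zss. set zs \<subseteq> phases"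
  shows "\<forall>g\<in>set (stage_gates N W f zss). unitary (2 * N * W) g"
  using assms(3-5)
proof (induction zss arbitrary: f)
  case (Cons zs zss)
  have "unitary (2 * N * W) g" if "z \<in> set zs" "g \<in> set (iteration_gates N W z)" for z g
    using that Cons.prems assms
    by (auto simp: iteration_gates_def phases_def intro!: unitary_phase_gate unitary_diffusion_gate
        split: prod.splits)
  moreover have "unitary (2 * N * W) g" if "g \<in> set (check_gates N W f)" for g
    using that Cons.prems assms
    by (auto simp: check_gates_def intro!: unitary_flag_gate unitary_one)
  moreover have "\<forall>g\<in>set (stage_gates N W (Suc f) zss). unitary (2 * N * W) g"
    using Cons.IH[of "Suc f"] Cons.prems by simp
  ultimately show ?case by auto
qed simp

lemma length_stage_gates:
  "length (stage_gates N W f zss) = (\<Sum>zs\<leftarrow>zss. 2 * length zs + 2)"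
proof (induction zss arbitrary: f)
  case (Cons zs zss)
  have "length (concat (map (iteration_gates N W) zs)) = 2 * length zs"
    by (induction zs) (auto simp: iteration_gates_def)
  thus ?case using Cons by (simp add: check_gates_def)
qed simp

text \<open>The extra \<open>2\<close> queries are an initial check with flag \<open>1\<close>: it
  turns the uniform superposition into a state with no amplitude on unflagged solutions, the input
  that the stages require.\<close>

lemma exists_staged_search:
  assumes N: "0 < N" and phases: "\<forall>zs\<in>set zss. set zs \<subseteq> phases"
  shows "\<exists>A. valid_algorithm N (2 + (\<Sum>zs\<leftarrow>zss. 2 * length zs + 2)) A \<and>
    (\<forall>x. search_error N (2 + (\<Sum>zs\<leftarrow>zss. 2 * length zs + 2)) A x \<le>
      (\<Prod>zs\<leftarrow>zss. cmod (fail_amplitude (real (card (solutions N x)) / (2 * real N)) zs))\<^sup>2)"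
proof -
  \<comment> \<open>Flags \<open>0\<close> to \<open>1 + length zss\<close>, each with the bit for
    dummies.\<close>
  define W where "W = 2 * (2 + length zss)"
  define d where "d = 2 * N * W"
  define gs where "gs = check_gates N W 1 @ stage_gates N W 2 zss"
  define T where "T = 2 + (\<Sum>zs\<leftarrow>zss. 2 * length zs + 2)"
  have W: "2 \<le> W" by (simp add: W_def)
  have len: "length gs = T"
    by (simp add: gs_def T_def check_gates_def length_stage_gates)
  define v0 where "v0 = vec d (\<lambda>i. complex_of_real (item_amplitude N (registers N i)))"
  define A where "A = \<lparr>work_dim = W, start = v0,
    gate = (\<lambda>k. if k = 0 then 1\<^sub>m d else gs ! (k - 1)), outcome = (\<lambda>i. i mod N)\<rparr>"
  have v0: "v0 \<in> carrier_vec d" by (simp add: v0_def)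
  have amp0: "v0 $ basis_index N r = of_real (item_amplitude N r)" if "r \<in> register_set N W" for r
    using that basis_index_less[OF that] by (simp add: v0_def d_def registers_basis_index)
  have "sq_norm_vec v0 = (\<Sum>r\<in>register_set N W. (item_amplitude N r)\<^sup>2)"
    using v0 by (simp add: sq_norm_vec_def d_def sum_basis_index[OF N] amp0)
  hence norm0: "v0 \<bullet>c v0 = 1"
    by (simp add: cscalar_prod_self sum_item_amplitude_sq[OF N W])
  have unit: "unitary d g" if "g \<in> set gs" for g
  proof -
    have "unitary d (flag_gate N W 1)"
      unfolding d_def using N by (intro unitary_flag_gate) (auto simp: W_def)
    moreover have "\<forall>g\<in>set (stage_gates N W 2 zss). unitary d g"
      unfolding d_def using unitary_stage_gates[OF N W _ _ phases, of 2] by (simp add: W_def)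
    ultimately show ?thesis
      using that unitary_one[of d] by (auto simp: gs_def check_gates_def d_def)
  qed
  have valid: "valid_algorithm N T A"
    unfolding valid_algorithm_def Let_def
    using N v0 norm0 W unit
    by (auto simp: A_def d_def[symmetric] unitary_one len[symmetric])
  have st: "state N A x k = run_gates N W x (take k gs) v0" if "k \<le> T" for x k
    using that
  proof (induction k)
    case 0
    show ?case using v0 by (simp add: A_def)
  next
    case (Suc k)
    hence "take (Suc k) gs = take k gs @ [gs ! k]"
      by (simp add: len take_Suc_conv_app_nth)
    thus ?case using Suc by (simp add: A_def)
  qed
  have "search_error N T A x \<le>
      (\<Prod>zs\<leftarrow>zss. cmod (fail_amplitude (real (card (solutions N x)) / (2 * real N)) zs))\<^sup>2" for x
  proof -
    let ?c = "\<Prod>zs\<leftarrow>zss. fail_amplitude (real (card (solutions N x)) / (2 * real N)) zs"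
    define \<beta>0 where "\<beta>0 = complex_of_real (1 / sqrt (2 * real N))"
    define v where "v = state N A x T"
    have "layered N W x 1 (\<beta>0, \<beta>0) v0"
      using v0 unfolding d_def
      by (rule layeredI) (auto simp: amp0 layered_amplitude_def item_amplitude_def \<beta>0_def)
    hence "layered N W x 2 (0, \<beta>0) (run_gates N W x (check_gates N W 1) v0)"
      using layered_check[of 1 W N x \<beta>0 \<beta>0 v0] by (simp add: W_def numeral_2_eq_2)
    hence "layered N W x (2 + length zss) (0, \<beta>0 * ?c) (run_gates N W x gs v0)"
      using layered_stages[OF N, of 2 zss W x \<beta>0] W by (simp add: gs_def W_def)
    hence lay: "layered N W x (2 + length zss) (0, \<beta>0 * ?c) v"
      by (simp add: v_def st len[symmetric])
    note v1 = layeredD(2)[OF lay] and v2 = layeredD(3)[OF lay]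
    have out: "outcome A (basis_index N (j, b, w)) = j" if "j < N" for j b w
      using that by (simp add: A_def basis_index_def)
    have "search_error N T A x = (\<Sum>i<2 * N * W. of_bool (\<not> x (outcome A i)) * (cmod (v $ i))\<^sup>2)"
      using search_error_eq[OF valid] by (simp add: v_def A_def)
    also have "\<dots> = (\<Sum>r\<in>register_set N W. of_bool (\<not> x (outcome A (basis_index N r))) * (cmod (v $ basis_index N r))\<^sup>2)"
      by (rule sum_basis_index[OF N])
    also have "\<dots> = (\<Sum>j<N. of_bool (\<not> x j) * (cmod (\<beta>0 * ?c))\<^sup>2 + of_bool (\<not> x j) * (cmod (\<beta>0 * ?c))\<^sup>2)"
    proof (rule sum_items[OF W])
      fix j b w assume r: "(j, b, w) \<in> register_set N W"
      hence "j < N" by (simp add: register_set_def)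
      thus "of_bool (\<not> x (outcome A (basis_index N (j, b, w)))) * (cmod (v $ basis_index N (j, b, w)))\<^sup>2 =
          (if \<not> b \<and> w < 2 then of_bool (\<not> x j) * (cmod (\<beta>0 * ?c))\<^sup>2 else 0)"
        using r by (cases "x j"; cases "w < 2") (auto simp: out v1 v2 layered_amplitude_def)
    qed
    \<comment> \<open>The real and the dummy copy of an index both report that index. All
      \<open>2 * N\<close> copies together weigh \<open>(cmod ?c)\<^sup>2\<close>, because
      \<open>\<beta>0\<close> has squared modulus \<open>1 / (2 * N)\<close>.\<close>
    also have "\<dots> \<le> (\<Sum>j<N. 2 * (cmod (\<beta>0 * ?c))\<^sup>2)"
      by (intro sum_mono) (auto simp: of_bool_def)
    also have "\<dots> = (cmod ?c)\<^sup>2"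
      using N by (simp add: \<beta>0_def norm_mult norm_divide power_mult_distrib power_divide)
    also have "cmod ?c = (\<Prod>zs\<leftarrow>zss. cmod (fail_amplitude (real (card (solutions N x)) / (2 * real N)) zs))"
      by (induction zss) (auto simp: norm_mult)
    finally show ?thesis .
  qed
  thus ?thesis using valid unfolding T_def by blast
qed

subsection \<open>The upper bound on the number of queries\<close>

lemma prod_list_unit_interval:
  fixes xs :: "real list"
  assumes "\<And>y. y \<in> set xs \<Longrightarrow> 0 \<le> y \<and> y \<le> 1"
  shows "0 \<le> prod_list xs \<and> prod_list xs \<le> 1"
  using assms by (induction xs) (auto intro: mult_le_one)

lemma prod_list_le_member:
  fixes xs :: "real list"
  assumes "\<And>y. y \<in> set xs \<Longrightarrow> 0 \<le> y \<and> y \<le> 1" and "c \<in> set xs"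
  shows "prod_list xs \<le> c"
  using assms
proof (induction xs)
  case (Cons y ys)
  have ys: "0 \<le> prod_list ys \<and> prod_list ys \<le> 1"
    using Cons.prems by (intro prod_list_unit_interval) auto
  have y: "0 \<le> y" "y \<le> 1" using Cons.prems(1)[of y] by auto
  show ?case
  proof (cases "c = y")
    case True
    thus ?thesis using mult_left_mono[of "prod_list ys" 1 y] ys y by simp
  next
    case False
    hence "prod_list ys \<le> c" using Cons by auto
    thus ?thesis using mult_right_mono[of y 1 "prod_list ys"] ys y by simp
  qed
qed simp

lemma prod_list_concat_replicate:
  "prod_list (map f (concat (replicate n xs))) = (prod_list (map f xs) :: 'a :: comm_monoid_mult) ^ n"
  by (induction n) auto

lemma sum_list_concat_replicate:
  "sum_list (map f (concat (replicate n xs))) = n * (sum_list (map f xs) :: nat)"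
  by (induction n) auto

lemma grover_angle_ratio:
  assumes "1 \<le> k" "k \<le> N"
  shows "pi / (2 * grover_angle (real k / (2 * real N))) \<le> 2 * sqrt (real N / real k)"
proof -
  let ?p = "real k / (2 * real N)" and ?s = "sqrt (real N / real k)"
  have p: "0 < ?p" "?p \<le> 1 / 2" using assms by (auto simp: field_simps)
  have s: "0 < ?s" using assms by simp
  have "1 / 4 * (real k / real N) \<le> ?p" using assms by (simp add: field_simps)
  hence "sqrt (1 / 4 * (real k / real N)) \<le> sqrt ?p" by (rule real_sqrt_le_mono)
  moreover have "sqrt (1 / 4 * (real k / real N)) = 1 / 2 * (1 / ?s)"
    by (simp only: real_sqrt_mult) (simp add: real_sqrt_divide)
  ultimately have "1 / ?s \<le> grover_angle ?p"
    using grover_angle_bounds(3)[OF p] by linarith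
  hence "1 \<le> grover_angle ?p * ?s" using s by (simp add: field_simps)
  hence "pi \<le> 4 * (grover_angle ?p * ?s)" using pi_less_4 by simp
  thus ?thesis
    using grover_angle_bounds(1)[OF p] by (simp add: field_simps)
qed

text \<open>For \<open>k < K\<close> solutions the exact stage for \<open>k\<close> makes the
  product zero. For \<open>k \<ge> K\<close> each of the \<open>n\<close> rounds contains a suitable
  power of two, found without knowing \<open>k\<close>.\<close>

lemma exists_schedule:
  assumes t: "1 \<le> t" "t \<le> K" "K \<le> N"
  shows "\<exists>zss. (\<forall>zs\<in>set zss. set zs \<subseteq> phases) \<and>
    (\<forall>k. t \<le> k \<and> k \<le> N \<longrightarrow>
      (\<Prod>zs\<leftarrow>zss. cmod (fail_amplitude (real k / (2 * real N)) zs))\<^sup>2 \<le> (1 / 2) ^ n) \<and>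
    real (\<Sum>zs\<leftarrow>zss. 2 * length zs + 2) \<le>
      8 * (\<Sum>k = t..<K. sqrt (real N / real k)) + 12 * real n * sqrt (real N / real K)"
proof -
  let ?p = "\<lambda>k. real k / (2 * real N)"
  have N: "0 < N" using t by simp
  have p: "0 < ?p k" "?p k \<le> 1 / 2" if "1 \<le> k" "k \<le> N" for k
    using that by (auto simp: field_simps)
  have s1: "1 \<le> sqrt (real N / real k)" if "1 \<le> k" "k \<le> N" for k
    using that by (simp add: field_simps)
  have "\<exists>zs. set zs \<subseteq> phases \<and> real (2 * length zs + 2) \<le> 8 * sqrt (real N / real k) \<and>
      fail_amplitude (?p k) zs = 0" if k: "1 \<le> k" "k \<le> N" for k
  proof -
    obtain zs where zs: "set zs \<subseteq> phases" "fail_amplitude (?p k) zs = 0"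
      "real (length zs) \<le> pi / (2 * grover_angle (?p k)) + 1"
      using exact_search[OF p[OF k]] by blast
    \<comment> \<open>With \<open>s = sqrt (N / k) \<ge> 1\<close> the length is at most
      \<open>2 * s + 1\<close>, and \<open>4 * s + 4 \<le> 8 * s\<close>.\<close>
    moreover have "real (2 * length zs + 2) = 2 * real (length zs) + 2" by simp
    hence "real (2 * length zs + 2) \<le> 8 * sqrt (real N / real k)"
      using zs(3) grover_angle_ratio[OF k] s1[OF k] by linarith
    ultimately show ?thesis by blast
  qed
  then obtain ex where ex: "\<And>k. 1 \<le> k \<Longrightarrow> k \<le> N \<Longrightarrow> set (ex k) \<subseteq> phases"
    "\<And>k. 1 \<le> k \<Longrightarrow> k \<le> N \<Longrightarrow> real (2 * length (ex k) + 2) \<le> 8 * sqrt (real N / real k)"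
    "\<And>k. 1 \<le> k \<Longrightarrow> k \<le> N \<Longrightarrow> fail_amplitude (?p k) (ex k) = 0"
    by metis
  let ?s = "sqrt (real N / real K)" and ?\<phi> = "grover_angle (?p K)"
  have K: "1 \<le> K" "K \<le> N" using t by auto
  note \<phi>K = grover_angle_bounds[OF p[OF K]]
  \<comment> \<open>At the first \<open>i\<close> with this property the rotation lies between
    \<open>pi / 4\<close> and \<open>pi / 2\<close>: either \<open>i = 0\<close> and the angle
    itself is at most \<open>pi / 2\<close>, or the previous power stayed below
    \<open>pi / 4\<close>. The squared cosine is then at most \<open>1 / 2\<close>.\<close>
  define reaches where "reaches \<phi> i \<longleftrightarrow> pi / 4 \<le> 2 ^ i * \<phi>" for \<phi> :: real and i :: nat
  have first: "\<exists>i. reaches \<phi> i \<and> (\<forall>j<i. \<not> reaches \<phi> j)" if "0 < \<phi>" for \<phi>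
  proof -
    obtain i where "pi / 4 / \<phi> < 2 ^ i" using real_arch_pow[of 2 "pi / 4 / \<phi>"] by auto
    hence "reaches \<phi> i" using that by (simp add: reaches_def field_simps)
    thus ?thesis using exists_least_iff[of "reaches \<phi>"] by blast
  qed
  obtain r where r: "reaches ?\<phi> r" "\<forall>j<r. \<not> reaches ?\<phi> j"
    using first[OF \<phi>K(1)] by blast
  have r_bound: "2 ^ r \<le> 2 * ?s"
  proof (cases r)
    case 0
    thus ?thesis unfolding 0 power_0 using s1[OF K] by linarith
  next
    case (Suc i)
    hence "2 ^ i * ?\<phi> < pi / 4" using r(2) by (auto simp: reaches_def)
    hence "2 ^ r < pi / (2 * ?\<phi>)" using \<phi>K(1) by (simp add: Suc field_simps)
    thus ?thesis using grover_angle_ratio[OF K] by simp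
  qed
  define E where "E = map (\<lambda>i. replicate (2 ^ i) (-1 :: complex, -1 :: complex)) [0..<Suc r]"
  have E_phases: "set zs \<subseteq> phases" if "zs \<in> set E" for zs
    using that by (auto simp: E_def phases_def)
  \<comment> \<open>The \<open>2\<close> added on the left avoids subtraction on naturals. For
    \<open>m = r + 1\<close> the cost is \<open>4 * 2 ^ r + 2 * r\<close>, at most
    \<open>6 * 2 ^ r\<close>.\<close>
  have cost_pow: "(\<Sum>zs\<leftarrow>map (\<lambda>i. replicate (2 ^ i) (-1 :: complex, -1 :: complex)) [0..<m]. 2 * length zs + 2) + 2
      = 2 * 2 ^ m + 2 * m" for m
    by (induction m) auto
  have "(\<Sum>zs\<leftarrow>E. 2 * length zs + 2) \<le> 6 * 2 ^ r"
    using cost_pow[of "Suc r"] less_exp[of r] unfolding E_def by simp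
  hence "real (\<Sum>zs\<leftarrow>E. 2 * length zs + 2) \<le> real (6 * 2 ^ r)"
    by (simp only: of_nat_le_iff)
  also have "real (6 * 2 ^ r) = 6 * 2 ^ r" by simp
  finally have E_cost: "real (\<Sum>zs\<leftarrow>E. 2 * length zs + 2) \<le> 12 * ?s"
    using r_bound by linarith
  define zss where "zss = map ex [t..<K] @ concat (replicate n E)"
  have phases: "\<forall>zs\<in>set zss. set zs \<subseteq> phases"
  proof
    fix zs assume "zs \<in> set zss"
    hence "(\<exists>k. t \<le> k \<and> k < K \<and> zs = ex k) \<or> zs \<in> set E"
      by (auto simp: zss_def)
    thus "set zs \<subseteq> phases"
      using ex(1) E_phases t by (metis le_trans less_imp_le)
  qed
  have unit: "0 \<le> cmod (fail_amplitude (?p k) zs) \<and> cmod (fail_amplitude (?p k) zs) \<le> 1"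
    if "zs \<in> set zss \<union> set E" "k \<le> N" for k zs
    using that phases E_phases fail_amplitude_le_1[of zs "?p k"] N by (auto simp: field_simps)
  have "(\<Prod>zs\<leftarrow>zss. cmod (fail_amplitude (?p k) zs))\<^sup>2 \<le> (1 / 2) ^ n" if k: "t \<le> k" "k \<le> N" for k
  proof -
    let ?f = "\<lambda>zs. cmod (fail_amplitude (?p k) zs)"
    have unit': "\<And>y. y \<in> set (map ?f zss) \<Longrightarrow> 0 \<le> y \<and> y \<le> 1" using unit k by auto
    show ?thesis
    proof (cases "k < K")
      case True
      have "ex k \<in> set zss" using k True by (auto simp: zss_def)
      hence "0 \<in> ?f ` set zss" using ex(3)[of k] k t by (auto intro!: rev_image_eqI)
      hence zero: "(\<Prod>zs\<leftarrow>zss. ?f zs) = 0" by (simp add: prod_list_zero_iff)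
      show ?thesis unfolding zero by simp
    next
      case False
      have k1: "1 \<le> k" using k t by simp
      let ?\<psi> = "grover_angle (?p k)"
      \<comment> \<open>More solutions mean a larger angle, so the power needed for \<open>k\<close>
        is at most the one for \<open>K\<close> and occurs in \<open>E\<close>.\<close>
      have le: "?\<phi> \<le> ?\<psi>"
        using p[OF K] p[OF k1 k(2)] False N by (intro grover_angle_mono) (auto intro!: divide_right_mono)
      note \<psi> = grover_angle_bounds[OF p[OF k1 k(2)]]
      obtain i where i: "reaches ?\<psi> i" "\<forall>j<i. \<not> reaches ?\<psi> j"
        using first[OF \<psi>(1)] by blast
      have "2 ^ r * ?\<phi> \<le> 2 ^ r * ?\<psi>" using le by (intro mult_left_mono) auto
      hence "reaches ?\<psi> r" using r(1) unfolding reaches_def by (rule order_trans[rotated])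
      hence ir: "i \<le> r" using i(2) by (meson not_le)
      have hi: "2 ^ i * ?\<psi> \<le> pi / 2"
      proof (cases i)
        case 0
        thus ?thesis using \<psi>(2) by simp
      next
        case (Suc j)
        hence "2 ^ j * ?\<psi> < pi / 4" using i(2) by (auto simp: reaches_def)
        thus ?thesis by (simp add: Suc)
      qed
      have "0 \<le> cos (2 ^ i * ?\<psi>)" using hi \<psi>(1) by (intro cos_ge_zero) (auto intro: order_trans[of _ 0])
      moreover have "cos (2 ^ i * ?\<psi>) \<le> cos (pi / 4)"
        using i(1) hi by (intro cos_monotone_0_pi_le) (auto simp: reaches_def)
      ultimately have "\<bar>cos (2 ^ i * ?\<psi>)\<bar> \<le> sqrt 2 / 2" by (simp add: cos_45)
      moreover have "?f (replicate (2 ^ i) (-1, -1)) = \<bar>cos (2 ^ i * ?\<psi>)\<bar>"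
        using fail_amplitude_grover[OF p[OF k1 k(2)], of "2 ^ i"] by simp
      moreover have "replicate (2 ^ i) (-1, -1) \<in> set E" using ir by (auto simp: E_def)
      hence "prod_list (map ?f E) \<le> ?f (replicate (2 ^ i) (-1, -1))"
        using unit k by (intro prod_list_le_member) auto
      ultimately have "prod_list (map ?f E) \<le> sqrt 2 / 2" by linarith
      moreover have E0: "0 \<le> prod_list (map ?f E)"
        using unit k by (intro prod_list_unit_interval[THEN conjunct1]) auto
      ultimately have "(prod_list (map ?f E))\<^sup>2 \<le> (sqrt 2 / 2)\<^sup>2" by (intro power_mono)
      hence half: "(prod_list (map ?f E))\<^sup>2 \<le> 1 / 2" by (simp add: power_divide)
      have ex1: "0 \<le> prod_list (map ?f (map ex [t..<K])) \<and> prod_list (map ?f (map ex [t..<K])) \<le> 1"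
        using unit k by (intro prod_list_unit_interval) (auto simp: zss_def)
      have "(\<Prod>zs\<leftarrow>zss. ?f zs) = prod_list (map ?f (map ex [t..<K])) * prod_list (map ?f E) ^ n"
        by (simp add: zss_def prod_list_concat_replicate)
      also have "\<dots> \<le> 1 * prod_list (map ?f E) ^ n"
        using ex1 E0 by (intro mult_right_mono) auto
      finally have "(\<Prod>zs\<leftarrow>zss. ?f zs)\<^sup>2 \<le> (prod_list (map ?f E) ^ n)\<^sup>2"
        using prod_list_unit_interval[of "map ?f zss"] unit' by (intro power_mono) auto
      also have "\<dots> = ((prod_list (map ?f E))\<^sup>2) ^ n" by (simp only: power_mult[symmetric] mult.commute)
      also have "\<dots> \<le> (1 / 2) ^ n" using half by (intro power_mono) auto
      finally show ?thesis .
    qed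
  qed
  moreover have "real (\<Sum>zs\<leftarrow>zss. 2 * length zs + 2) \<le>
      8 * (\<Sum>k = t..<K. sqrt (real N / real k)) + 12 * real n * ?s"
  proof -
    have "(\<Sum>zs\<leftarrow>zss. 2 * length zs + 2) =
        (\<Sum>k = t..<K. 2 * length (ex k) + 2) + n * (\<Sum>zs\<leftarrow>E. 2 * length zs + 2)"
      unfolding zss_def map_append sum_list_append sum_list_concat_replicate
      by (simp add: interv_sum_list_conv_sum_set_nat comp_def)
    hence "real (\<Sum>zs\<leftarrow>zss. 2 * length zs + 2) =
        (\<Sum>k = t..<K. real (2 * length (ex k) + 2)) + real n * real (\<Sum>zs\<leftarrow>E. 2 * length zs + 2)"
      by (simp only: of_nat_add of_nat_mult of_nat_sum)
    also have "\<dots> \<le> (\<Sum>k = t..<K. 8 * sqrt (real N / real k)) + real n * (12 * ?s)"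
      using ex(2) t by (intro add_mono sum_mono mult_left_mono E_cost) auto
    finally show ?thesis by (simp add: sum_distrib_left mult_ac)
  qed
  ultimately show ?thesis using phases by blast
qed

text \<open>Telescoping: \<open>1 / sqrt (m + 1)\<close> is at most
  \<open>2 * sqrt (m + 1) - 2 * sqrt m\<close>.\<close>

lemma sum_inverse_sqrt:
  assumes "1 \<le> t"
  shows "(\<Sum>k = t..<Suc m. 1 / sqrt (real k)) \<le> 2 * sqrt (real m)"
proof (induction m)
  case 0
  show ?case using assms by simp
next
  case (Suc m)
  show ?case
  proof (cases "t \<le> Suc m")
    case True
    define a b where "a = sqrt (real m)" and "b = sqrt (real (Suc m))"
    have sq: "a\<^sup>2 = real m" "b\<^sup>2 = real m + 1" and b: "0 < b" by (auto simp: a_def b_def)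
    have "0 \<le> (b - a)\<^sup>2" by simp
    hence "2 * a * b \<le> 2 * b\<^sup>2 - 1" using sq by (simp add: power2_diff mult_ac)
    moreover have "(2 * b - 2 * a) * b = 2 * b\<^sup>2 - 2 * a * b"
      by (simp add: power2_eq_square algebra_simps)
    ultimately have "1 \<le> (2 * b - 2 * a) * b" by linarith
    hence "1 / b \<le> 2 * b - 2 * a"
      by (simp only: pos_divide_le_eq[OF b])
    hence "1 / sqrt (real (Suc m)) \<le> 2 * sqrt (real (Suc m)) - 2 * sqrt (real m)"
      unfolding a_def b_def .
    thus ?thesis using Suc True by simp
  qed (use assms in simp)
qed

lemma search_upper_bound:
  assumes "(N, t, \<epsilon>) \<in> search_params \<eta> \<epsilon>0" and \<eta>: "\<eta> < 1" and \<epsilon>0: "\<epsilon>0 < 1"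
  defines "n \<equiv> nat \<lceil>log 2 (1 / \<epsilon>)\<rceil>"
  shows "\<exists>T A. valid_algorithm N T A \<and> search_error_le N t T A \<epsilon> \<and>
    (real T)\<^sup>2 / real N + real T * sqrt (real t / real N) \<le> 922 * real n"
proof -
  have N: "0 < N" and t: "1 \<le> t" "real t \<le> \<eta> * real N" and eps: "1 / 2 ^ N \<le> \<epsilon>" "\<epsilon> \<le> \<epsilon>0"
    using assms by (auto simp: search_params_def)
  have eps0: "0 < \<epsilon>" using eps(1) by (meson less_le_trans zero_less_divide_1_iff zero_less_numeral zero_less_power)
  have "\<eta> * real N \<le> 1 * real N" using \<eta> by (intro mult_right_mono) auto
  hence tN: "t \<le> N" using t by simp
  define L where "L = log 2 (1 / \<epsilon>)"
  have L: "0 < L" using eps0 eps \<epsilon>0 by (simp add: L_def)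
  have "1 / \<epsilon> \<le> 2 ^ N" using eps(1) eps0 by (simp add: field_simps)
  hence "L \<le> real N" using eps0 by (simp add: L_def log_le_iff powr_realpow)
  hence nN: "n \<le> N" unfolding n_def L_def[symmetric] by (simp add: nat_le_iff ceiling_le_iff)
  have n1: "1 \<le> n" using L unfolding n_def L_def[symmetric] by (simp add: le_nat_iff)
  have nL: "L \<le> real n" unfolding n_def L_def[symmetric] by linarith
  have half: "(1 / 2) ^ n \<le> \<epsilon>"
  proof -
    have "1 / \<epsilon> = 2 powr L" using eps0 by (simp add: L_def)
    also have "\<dots> \<le> 2 powr real n" using nL by simp
    also have "\<dots> = 2 ^ n" by (simp add: powr_realpow)
    finally show ?thesis using eps0 by (simp add: power_divide field_simps)
  qed
  \<comment> \<open>This choice balances the two phases: \<open>K - t \<le> n\<close> bounds the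
    number of exact searches, \<open>t \<le> K\<close> gives
    \<open>sqrt (N / K) * sqrt (t / N) \<le> 1\<close>, and \<open>n \<le> K\<close> gives
    \<open>n * sqrt (N / K) \<le> sqrt (N * n)\<close>. That \<open>K \<le> N\<close> relies on
    \<open>\<epsilon> \<ge> 1 / 2 ^ N\<close>.\<close>
  define K where "K = max t n"
  have K: "t \<le> K" "K \<le> N" "n \<le> K" "1 \<le> K" using tN nN t by (auto simp: K_def)
  obtain zss where zss: "\<forall>zs\<in>set zss. set zs \<subseteq> phases"
    "\<And>k. t \<le> k \<Longrightarrow> k \<le> N \<Longrightarrow> (\<Prod>zs\<leftarrow>zss. cmod (fail_amplitude (real k / (2 * real N)) zs))\<^sup>2 \<le> (1 / 2) ^ n"
    "real (\<Sum>zs\<leftarrow>zss. 2 * length zs + 2) \<le>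
      8 * (\<Sum>k = t..<K. sqrt (real N / real k)) + 12 * real n * sqrt (real N / real K)"
    using exists_schedule[OF t(1) K(1,2), of n] by blast
  define T where "T = 2 + (\<Sum>zs\<leftarrow>zss. 2 * length zs + 2)"
  obtain A where A: "valid_algorithm N T A"
    "\<And>x. search_error N T A x \<le>
      (\<Prod>zs\<leftarrow>zss. cmod (fail_amplitude (real (card (solutions N x)) / (2 * real N)) zs))\<^sup>2"
    using exists_staged_search[OF N zss(1)] unfolding T_def by blast
  have "search_error N T A x \<le> \<epsilon>" if "t \<le> card (solutions N x)" for x
  proof -
    have "card (solutions N x) \<le> N"
      using card_mono[of "{..<N}" "solutions N x"] by (auto simp: solutions_def)
    thus ?thesis using A(2)[of x] zss(2)[OF that] half by linarith
  qed
  hence err: "search_error_le N t T A \<epsilon>"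
    by (simp add: search_error_le_def search_error_def)
  let ?\<tau> = "sqrt (real t / real N)"
  let ?S = "\<Sum>k = t..<K. sqrt (real N / real k)"
  have T: "real T \<le> 2 + 8 * ?S + 12 * real n * sqrt (real N / real K)"
    using zss(3) by (simp only: T_def of_nat_add of_nat_numeral)
  have le1: "sqrt (real N / real k) * ?\<tau> \<le> 1" if "t \<le> k" for k
  proof -
    have "sqrt (real N / real k) * ?\<tau> = sqrt (real t / real k)"
      using N by (simp add: real_sqrt_mult[symmetric])
    also have "\<dots> \<le> 1" using that t by (simp add: field_simps)
    finally show ?thesis .
  qed
  have "real T * ?\<tau> \<le> (2 + 8 * ?S + 12 * real n * sqrt (real N / real K)) * ?\<tau>"
    using T by (intro mult_right_mono) auto
  also have "\<dots> = 2 * ?\<tau> + 8 * (\<Sum>k = t..<K. sqrt (real N / real k) * ?\<tau>)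
      + 12 * real n * (sqrt (real N / real K) * ?\<tau>)"
    by (simp only: distrib_right mult.assoc sum_distrib_right)
  also have "\<dots> \<le> 2 * 1 + 8 * (\<Sum>k = t..<K. 1) + 12 * real n * 1"
    using tN N K le1 by (intro add_mono mult_left_mono sum_mono) auto
  also have "\<dots> = 2 + 8 * real (K - t) + 12 * real n" by simp
  also have "\<dots> \<le> 2 * real n + 8 * real n + 12 * real n"
    using n1 by (auto simp: K_def max_def)
  finally have 1: "real T * ?\<tau> \<le> 22 * real n" by simp
  have S: "?S \<le> sqrt (real N) * (2 * sqrt (real n))"
  proof (cases "t < n")
    case True
    hence Kn: "K = Suc (n - 1)" by (simp add: K_def)
    have "?S = sqrt (real N) * (\<Sum>k = t..<K. 1 / sqrt (real k))"
      by (simp add: sum_distrib_left real_sqrt_divide)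
    also have "\<dots> \<le> sqrt (real N) * (2 * sqrt (real n))"
    proof (rule mult_left_mono)
      have "(\<Sum>k = t..<K. 1 / sqrt (real k)) \<le> 2 * sqrt (real (n - 1))"
        unfolding Kn by (rule sum_inverse_sqrt[OF t(1)])
      also have "\<dots> \<le> 2 * sqrt (real n)" by simp
      finally show "(\<Sum>k = t..<K. 1 / sqrt (real k)) \<le> 2 * sqrt (real n)" .
    qed simp
    finally show ?thesis .
  next
    case False
    hence "K = t" by (simp add: K_def)
    thus ?thesis by simp
  qed
  have "real n * sqrt (real N / real K) \<le> sqrt (real N) * sqrt (real n)"
  proof -
    have "real n * sqrt (real N / real K) = (sqrt (real n) * sqrt (real n)) * (sqrt (real N) / sqrt (real K))"
      by (simp add: real_sqrt_divide)
    also have "\<dots> = sqrt (real n) / sqrt (real K) * (sqrt (real N) * sqrt (real n))"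
      by (simp only: times_divide_eq_left times_divide_eq_right mult_ac)
    also have "\<dots> \<le> 1 * (sqrt (real N) * sqrt (real n))"
      using K by (intro mult_right_mono) auto
    finally show ?thesis by simp
  qed
  moreover have "1 * 1 \<le> sqrt (real N) * sqrt (real n)"
    using N n1 by (intro mult_mono) auto
  \<comment> \<open>\<open>30 = 2 + 8 * 2 + 12\<close>. Its square, together with the
    \<open>22\<close> from the linear term, makes up \<open>922\<close>.\<close>
  ultimately have "real T \<le> 30 * (sqrt (real N) * sqrt (real n))"
    using T S by linarith
  hence "(real T)\<^sup>2 \<le> (30 * (sqrt (real N) * sqrt (real n)))\<^sup>2" by (intro power_mono) auto
  hence "(real T)\<^sup>2 \<le> 900 * real n * real N" by (simp add: power_mult_distrib mult_ac)
  hence 2: "(real T)\<^sup>2 / real N \<le> 900 * real n" using N by (simp add: field_simps)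
  show ?thesis
    using A(1) err 1 2 by (intro exI[of _ T] exI[of _ A]) simp
qed

theorem theorem4:
  fixes \<eta> \<epsilon>0 :: real
  assumes "0 < \<eta>" and "\<eta> < 1" and "0 < \<epsilon>0" and "\<epsilon>0 < 1"
  shows "(\<lambda>(N, t, \<epsilon>). log 2 (1 / \<epsilon>)) \<in> \<Theta>[principal (search_params \<eta> \<epsilon>0)](
    \<lambda>(N, t, \<epsilon>). (real (optimal_queries N t \<epsilon>))\<^sup>2 / real N
       + real (optimal_queries N t \<epsilon>) * sqrt (real t / real N))"
proof -
  obtain C where C: "0 < C" and lower: "\<And>N t T A \<epsilon>. (N, t, \<epsilon>) \<in> search_params \<eta> \<epsilon>0 \<Longrightarrow>
    valid_algorithm N T A \<Longrightarrow> search_error_le N t T A \<epsilon> \<Longrightarrow>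
    log 2 (1 / \<epsilon>) \<le> C * ((real T)\<^sup>2 / real N + real T * sqrt (real t / real N))"
    using search_lower_bound[OF assms] by blast
  define L0 where "L0 = log 2 (1 / \<epsilon>0)"
  have L0: "0 < L0" using assms by (simp add: L0_def)
  \<comment> \<open>Rounding up gives \<open>n \<le> L + 1\<close> for
    \<open>L = log 2 (1 / \<epsilon>)\<close>, and \<open>1 \<le> L / L0\<close> because
    \<open>\<epsilon> \<le> \<epsilon>0\<close>; the factor \<open>1 + 1 / L0\<close> pays for the
    rounding.\<close>
  define c where "c = 1 / (922 * (1 + 1 / L0))"
  have c: "0 < c" using L0 by (simp add: c_def add_pos_pos)
  have bounds: "0 \<le> log 2 (1 / \<epsilon>) \<and>
      log 2 (1 / \<epsilon>) \<le> C * ((real (optimal_queries N t \<epsilon>))\<^sup>2 / real N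
        + real (optimal_queries N t \<epsilon>) * sqrt (real t / real N)) \<and>
      c * ((real (optimal_queries N t \<epsilon>))\<^sup>2 / real N
        + real (optimal_queries N t \<epsilon>) * sqrt (real t / real N)) \<le> log 2 (1 / \<epsilon>)"
    if par: "(N, t, \<epsilon>) \<in> search_params \<eta> \<epsilon>0" for N t \<epsilon>
  proof -
    let ?P = "\<lambda>T. \<exists>A. valid_algorithm N T A \<and> search_error_le N t T A \<epsilon>"
    let ?n = "nat \<lceil>log 2 (1 / \<epsilon>)\<rceil>"
    obtain T where T: "?P T" "(real T)\<^sup>2 / real N + real T * sqrt (real t / real N) \<le> 922 * real ?n"
      using search_upper_bound[OF par assms(2,4)] by blast
    \<comment> \<open>The lower bound applies to the optimal algorithm itself; the upper bound
      passes from \<open>T\<close> to the optimum because the expression is monotone in the number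
      of queries.\<close>
    have opt: "?P (optimal_queries N t \<epsilon>)" and le: "optimal_queries N t \<epsilon> \<le> T"
      unfolding optimal_queries_def using LeastI[of ?P, OF T(1)] Least_le[of ?P, OF T(1)] by auto
    have eps: "0 < \<epsilon>" "\<epsilon> \<le> \<epsilon>0" using par
      by (auto simp: search_params_def intro: less_le_trans[of 0 "1 / 2 ^ N"])
    have L: "L0 \<le> log 2 (1 / \<epsilon>)" using eps assms by (simp add: L0_def divide_left_mono)
    have "real ?n \<le> log 2 (1 / \<epsilon>) + 1" using L L0 by linarith
    also have "\<dots> \<le> log 2 (1 / \<epsilon>) + log 2 (1 / \<epsilon>) / L0" using L L0 by simp
    also have "\<dots> = (1 + 1 / L0) * log 2 (1 / \<epsilon>)" by (simp add: algebra_simps)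
    finally have "922 * real ?n \<le> 922 * ((1 + 1 / L0) * log 2 (1 / \<epsilon>))" by (rule mult_left_mono) simp
    hence "922 * real ?n \<le> 922 * (1 + 1 / L0) * log 2 (1 / \<epsilon>)" by (simp only: mult.assoc)
    moreover have "(real (optimal_queries N t \<epsilon>))\<^sup>2 / real N
        + real (optimal_queries N t \<epsilon>) * sqrt (real t / real N) \<le>
        (real T)\<^sup>2 / real N + real T * sqrt (real t / real N)"
      using le by (intro add_mono divide_right_mono mult_right_mono power_mono) auto
    ultimately have "(real (optimal_queries N t \<epsilon>))\<^sup>2 / real N
        + real (optimal_queries N t \<epsilon>) * sqrt (real t / real N) \<le> 922 * (1 + 1 / L0) * log 2 (1 / \<epsilon>)"
      using T(2) by linarith
    hence "c * ((real (optimal_queries N t \<epsilon>))\<^sup>2 / real N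
        + real (optimal_queries N t \<epsilon>) * sqrt (real t / real N)) \<le>
        c * (922 * (1 + 1 / L0) * log 2 (1 / \<epsilon>))"
      using c by (intro mult_left_mono) auto
    also have "\<dots> = (c * (922 * (1 + 1 / L0))) * log 2 (1 / \<epsilon>)" by (simp only: mult.assoc)
    also have "c * (922 * (1 + 1 / L0)) = 1" using c by (simp add: c_def)
    finally show ?thesis using lower[OF par] opt L L0 by auto
  qed
  show ?thesis
  proof (rule bigthetaI)
    show "(\<lambda>(N, t, \<epsilon>). log 2 (1 / \<epsilon>)) \<in> O[principal (search_params \<eta> \<epsilon>0)](
      \<lambda>(N, t, \<epsilon>). (real (optimal_queries N t \<epsilon>))\<^sup>2 / real N
         + real (optimal_queries N t \<epsilon>) * sqrt (real t / real N))"
      by (rule bigoI[where c = C]) (use bounds in \<open>auto simp: eventually_principal\<close>)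
    show "(\<lambda>(N, t, \<epsilon>). log 2 (1 / \<epsilon>)) \<in> \<Omega>[principal (search_params \<eta> \<epsilon>0)](
      \<lambda>(N, t, \<epsilon>). (real (optimal_queries N t \<epsilon>))\<^sup>2 / real N
         + real (optimal_queries N t \<epsilon>) * sqrt (real t / real N))"
      by (rule landau_omega.bigI[OF c]) (use bounds in \<open>auto simp: eventually_principal\<close>)
  qed
qed

end
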